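(* Let $\lambda$ and $\mu$ be partitions of lengths $r_1$ and $r_2$, let $r=r_1+r_2$, and let $\alpha\in\mathbb{R}$ with $\alpha+r>-1$. For $n\in\mathbb{N}_{\lambda,\mu}$ let $0<x^{(\alpha)}_{1,n}\le\cdots\le x^{(\alpha)}_{N(n),n}$ denote the regular zeros of the exceptional Laguerre polynomial $L^{(\alpha)}_{\lambda,\mu,n}$, i.e. its zeros in $(0,\infty)$ listed with multiplicity, $N(n)$ being their number. Then for every bounded continuous function $f$ on the positive real line, $$\lim_{n\to\infty}\frac{1}{N(n)}\sum_{j=1}^{N(n)}f\left(\frac{x^{(\alpha)}_{j,n}}{N(n)}\right)=\frac{1}{2\pi}\int_0^4 f(x)\sqrt{\frac{4-x}{x}}\,dx,$$ where $n$ tends to infinity through $\mathbb{N}_{\lambda,\mu}$.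
   Context: For $\alpha\in\mathbb{R}$ and an integer $n\ge 0$, $L^{(\alpha)}_n(x)=\frac{e^x x^{-\alpha}}{n!}\frac{d^n}{dx^n}\left(e^{-x}x^{n+\alpha}\right)$ is the Laguerre polynomial of degree $n$ (so $L_n^{(\alpha)}(x)=\sum_{k=0}^n\binom{n+\alpha}{n-k}\frac{(-x)^k}{k!}$). For sufficiently differentiable functions, $\mathrm{Wr}[f_1,\dots,f_r]=\det\left(\frac{d^{j-1}}{dx^{j-1}}f_i\right)_{1\le i,j\le r}$ is the Wronskian (the empty Wronskian is $1$). A partition $\lambda=(\lambda_1,\dots,\lambda_{r_1})$ is a weakly decreasing (possibly empty) finite sequence of positive integers, $r_1$ is its length and $|\lambda|=\sum_j\lambda_j$. To partitions $\lambda$ of length $r_1$ and $\mu$ of length $r_2$ associate $n_j=\lambda_j+r_1-j$ ($1\le j\le r_1$), $m_j=\mu_j+r_2-j$ ($1\le j\le r_2$), $r=r_1+r_2$, and the functions $f_j(x)=L^{(\alpha)}_{n_j}(x)$ for $j=1,\dots,r_1$ and $f_{r_1+j}(x)=e^xL^{(\alpha)}_{m_j}(-x)$ for $j=1,\dots,r_2$. The degree sequence is $$\mathbb{N}_{\lambda,\mu}=\{n\in\{0,1,2,\dots\} : n\ge|\lambda|+|\mu|-r_1 \text{ and } n-|\lambda|-|\mu|\ne\lambda_j-j \text{ for } j=1,\dots,r_1\}.$$ For $n\in\mathbb{N}_{\lambda,\mu}$ the exceptional Laguerre polynomial is $$L^{(\alpha)}_{\lambda,\mu,n}(x)=e^{-r_2x}\,\mathrm{Wr}\left[f_1,\dots,f_r,L^{(\alpha)}_s\right](x),\qquad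 s=n-|\lambda|-|\mu|+r_1,$$ which is a polynomial of degree $n$. When $\alpha+r>-1$, $N(n)\to\infty$ as $n\to\infty$. *)

theory Defs
  imports "HOL-Analysis.Analysis" "Jordan_Normal_Form.Determinant"
begin

(* Both imported libraries define det, mat and ($); the Wronskian needs matrices whose size
   is a term, so the Jordan_Normal_Form versions are meant throughout. *)
hide_const (open) Determinants.det Finite_Cartesian_Product.mat

(* The explicit sum, because the functions below use L_n at negative arguments, where the
   Rodrigues formula would need powers x^(-a) of negative reals.  Lemma laguerre_rodrigues
   shows that it is the polynomial given by the Rodrigues formula. *)
definition laguerre :: "real \<Rightarrow> nat \<Rightarrow> real \<Rightarrow> real" where
  "laguerre a n x = (\<Sum>k\<le>n. ((real n + a) gchoose (n - k)) * (- x) ^ k / fact k)"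

definition wronskian :: "(real \<Rightarrow> real) list \<Rightarrow> real \<Rightarrow> real" where
  "wronskian fs x = det (mat (length fs) (length fs) (\<lambda>(i, j). (deriv ^^ j) (fs ! i) x))"

(* The part lam_j is lam ! (j - 1), for 1 \<le> j \<le> length lam. *)
definition is_partition :: "nat list \<Rightarrow> bool" where
  "is_partition lam \<longleftrightarrow> sorted_wrt (\<ge>) lam \<and> (\<forall>k\<in>set lam. k > 0)"

(* The numbers n_j (for lam) and m_j (for mu); nothing truncates for 1 \<le> j \<le> length lam. *)
definition shifted_part :: "nat list \<Rightarrow> nat \<Rightarrow> nat" where
  "shifted_part lam j = lam ! (j - 1) + length lam - j"

definition degree_seq :: "nat list \<Rightarrow> nat list \<Rightarrow> nat set" where
  "degree_seq lam mu = {n.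
     int n \<ge> int (sum_list lam) + int (sum_list mu) - int (length lam) \<and>
     (\<forall>j\<in>{1..length lam}.
        int n - int (sum_list lam) - int (sum_list mu) \<noteq> int (lam ! (j - 1)) - int j)}"

definition seed_functions :: "real \<Rightarrow> nat list \<Rightarrow> nat list \<Rightarrow> (real \<Rightarrow> real) list" where
  "seed_functions a lam mu =
     map (\<lambda>j. laguerre a (shifted_part lam j)) [1..<length lam + 1] @
     map (\<lambda>j x. exp x * laguerre a (shifted_part mu j) (- x)) [1..<length mu + 1]"

(* The subtraction on nat in the index s does not truncate for n in degree_seq lam mu. *)
definition exc_laguerre :: "real \<Rightarrow> nat list \<Rightarrow> nat list \<Rightarrow> nat \<Rightarrow> real \<Rightarrow> real" where
  "exc_laguerre a lam mu n x =
     exp (- real (length mu) * x) *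
     wronskian (seed_functions a lam mu @
       [laguerre a (n + length lam - (sum_list lam + sum_list mu))]) x"

(* The same object as an element of the type of polynomials, where zeros have a multiplicity.
   It exists and is unique: lemma poly_exc_laguerre_poly. *)
definition exc_laguerre_poly :: "real \<Rightarrow> nat list \<Rightarrow> nat list \<Rightarrow> nat \<Rightarrow> real poly" where
  "exc_laguerre_poly a lam mu n = (THE p. \<forall>x. poly p x = exc_laguerre a lam mu n x)"

definition regular_zeros :: "real \<Rightarrow> nat list \<Rightarrow> nat list \<Rightarrow> nat \<Rightarrow> real multiset" where
  "regular_zeros a lam mu n = filter_mset (\<lambda>x. x > 0) (proots (exc_laguerre_poly a lam mu n))"

definition num_regular_zeros :: "real \<Rightarrow> nat list \<Rightarrow> nat list \<Rightarrow> nat \<Rightarrow> nat" where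
  "num_regular_zeros a lam mu n = size (regular_zeros a lam mu n)"

(* The j-th regular zero in increasing order, for 1 \<le> j \<le> num_regular_zeros a lam mu n. *)
definition regular_zero :: "real \<Rightarrow> nat list \<Rightarrow> nat list \<Rightarrow> nat \<Rightarrow> nat \<Rightarrow> real" where
  "regular_zero a lam mu n j = sorted_list_of_multiset (regular_zeros a lam mu n) ! (j - 1)"

lemma higher_deriv_exp_powr:
  fixes b x :: real
  assumes "x > 0"
  shows "(deriv ^^ m) (\<lambda>x. exp (- x) * x powr b) x =
    (\<Sum>k\<le>m. real (m choose k) * (-1) ^ (m + k) *
       (fact k * (b gchoose k) * exp (- x) * x powr (b - real k)))"
  using assms
proof (induction m arbitrary: x)
  case 0
  then show ?case by simp
next
  case (Suc m)
  define t where "t = (\<lambda>k x. fact k * (b gchoose k) * exp (- x) * x powr (b - real k))"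
  have t': "(t k has_real_derivative t (Suc k) x - t k x) (at x)" for k
  proof -
    have *: "b * (b gchoose k) =
        real k * (b gchoose k) + real (Suc k) * (b gchoose Suc k)"
      using gbinomial_mult_1[of b k] by simp
    have "real (Suc k) * (b gchoose Suc k) = (b - real k) * (b gchoose k)"
      unfolding left_diff_distrib * by simp
    then have u: "fact (Suc k) * (b gchoose Suc k) = fact k * ((b - real k) * (b gchoose k))"
      by (simp only: fact_Suc of_nat_mult mult.assoc mult.left_commute)
    show ?thesis
      unfolding t_def u
      by (auto intro!: derivative_eq_intros simp: Suc.prems algebra_simps)
  qed
  define c where "c = (\<lambda>m k. real (m choose k) * (-1) ^ (m + k))"
  have "((\<lambda>x. \<Sum>k\<le>m. c m k * t k x) has_real_derivative
      (\<Sum>k\<le>m. c m k * (t (Suc k) x - t k x))) (at x)"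
    by (intro DERIV_sum DERIV_cmult t')
  moreover have "eventually (\<lambda>y. (deriv ^^ m) (\<lambda>x. exp (- x) * x powr b) y =
      (\<Sum>k\<le>m. c m k * t k y)) (nhds x)"
  proof -
    have "eventually (\<lambda>y. y \<in> {0<..}) (nhds x)"
      using Suc.prems by (intro eventually_nhds_in_open) auto
    then show ?thesis
      by eventually_elim (simp add: Suc.IH c_def t_def)
  qed
  ultimately have "(deriv ^^ Suc m) (\<lambda>x. exp (- x) * x powr b) x =
      (\<Sum>k\<le>m. c m k * (t (Suc k) x - t k x))"
    by (simp add: deriv_cong_ev[OF _ refl] DERIV_imp_deriv)
  also have "\<dots> = (\<Sum>k\<le>m. c m k * t (Suc k) x) - (\<Sum>k\<le>m. c m k * t k x)"
    by (simp add: right_diff_distrib sum_subtractf)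
  also have "(\<Sum>k\<le>m. c m k * t k x) = (\<Sum>k\<le>Suc m. c m k * t k x)"
    by (simp add: c_def)
  also have "\<dots> = c m 0 * t 0 x + (\<Sum>k\<le>m. c m (Suc k) * t (Suc k) x)"
    by (rule sum.atMost_Suc_shift)
  also have "(\<Sum>k\<le>m. c m k * t (Suc k) x) -
      (c m 0 * t 0 x + (\<Sum>k\<le>m. c m (Suc k) * t (Suc k) x)) =
      c (Suc m) 0 * t 0 x + (\<Sum>k\<le>m. c (Suc m) (Suc k) * t (Suc k) x)"
    by (simp add: c_def sum_subtractf [symmetric] ring_distribs sum_negf[symmetric] add.commute
        flip: sum.distrib)
  also have "\<dots> = (\<Sum>k\<le>Suc m. c (Suc m) k * t k x)"
    by (rule sum.atMost_Suc_shift [symmetric])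
  finally show ?case by (simp add: c_def t_def)
qed

lemma laguerre_rodrigues:
  assumes x: "x > 0"
  shows "laguerre a n x =
    exp x * x powr (- a) / fact n * (deriv ^^ n) (\<lambda>x. exp (- x) * x powr (real n + a)) x"
proof -
  have "exp x * x powr (- a) / fact n * (deriv ^^ n) (\<lambda>x. exp (- x) * x powr (real n + a)) x =
    (\<Sum>k\<le>n. exp x * x powr (- a) / fact n * (real (n choose k) * (-1) ^ (n + k) *
       (fact k * ((real n + a) gchoose k) * exp (- x) * x powr (real n + a - real k))))"
    by (simp add: higher_deriv_exp_powr[OF x] sum_distrib_left)
  also have "\<dots> = (\<Sum>k\<le>n. ((real n + a) gchoose k) * (- x) ^ (n - k) / fact (n - k))"
  proof (rule sum.cong [OF refl])
    fix k assume "k \<in> {..n}"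
    then have k: "k \<le> n" by simp
    have 1: "x powr (- a) * x powr (real n + a - real k) = x ^ (n - k)"
      using x k by (simp flip: powr_add powr_realpow add: of_nat_diff)
    have "(-1 :: real) ^ (n + k) = (-1) ^ (n - k + 2 * k)" using k by (simp add: add.commute)
    also have "\<dots> = (-1) ^ (n - k)" by (simp only: power_add power_mult) simp
    finally have 2: "(-1 :: real) ^ (n + k) * x ^ (n - k) = (- x) ^ (n - k)"
      by (simp flip: power_mult_distrib)
    have 3: "real (n choose k) * fact k / fact n = 1 / fact (n - k)"
      using k by (simp add: binomial_fact)
    have 4: "exp x * exp (- x) = 1" by (simp flip: exp_add)
    have "exp x * x powr (- a) / fact n * (real (n choose k) * (-1) ^ (n + k) *
       (fact k * ((real n + a) gchoose k) * exp (- x) * x powr (real n + a - real k))) =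
      (exp x * exp (- x)) * (real (n choose k) * fact k / fact n) *
        ((-1) ^ (n + k) * (x powr (- a) * x powr (real n + a - real k))) *
        ((real n + a) gchoose k)"
      by simp
    also have "\<dots> = ((real n + a) gchoose k) * (- x) ^ (n - k) / fact (n - k)"
      unfolding 1 2 3 4 by simp
    finally show "exp x * x powr (- a) / fact n * (real (n choose k) * (-1) ^ (n + k) *
       (fact k * ((real n + a) gchoose k) * exp (- x) * x powr (real n + a - real k))) =
      ((real n + a) gchoose k) * (- x) ^ (n - k) / fact (n - k)" .
  qed
  also have "\<dots> = laguerre a n x"
    unfolding laguerre_def
    by (rule sum.reindex_bij_witness[of _ "\<lambda>k. n - k" "\<lambda>k. n - k"]) auto
  finally show ?thesis ..
qed

lemma laguerre_is_poly: "\<exists>p. \<forall>x. laguerre a n x = poly p x"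
proof (intro exI allI)
  fix x
  show "laguerre a n x =
      poly (\<Sum>k\<le>n. Polynomial.smult (((real n + a) gchoose (n - k)) / fact k) ([:0, -1:] ^ k)) x"
    by (simp add: laguerre_def poly_sum)
qed

lemma higher_deriv_poly: "(deriv ^^ j) (poly p) = poly ((pderiv ^^ j) (p :: real poly))"
proof (induction j)
  case (Suc j)
  have "deriv (poly q) = poly (pderiv q)" for q :: "real poly"
    by (rule ext, rule DERIV_imp_deriv, rule poly_DERIV)
  then show ?case by (simp add: Suc)
qed simp

lemma higher_deriv_exp_poly:
  "\<exists>q. (deriv ^^ j) (\<lambda>x. exp x * poly p x) = (\<lambda>x. exp x * poly (q :: real poly) x)"
proof (induction j)
  case (Suc j)
  then obtain q where q: "(deriv ^^ j) (\<lambda>x. exp x * poly p x) = (\<lambda>x. exp x * poly q x)"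
    by blast
  have "deriv (\<lambda>x. exp x * poly q x) = (\<lambda>x. exp x * poly (q + pderiv q) x)"
    by (rule ext, rule DERIV_imp_deriv)
       (auto intro!: derivative_eq_intros poly_DERIV simp: algebra_simps)
  then show ?case unfolding funpow.simps o_def q by blast
qed auto

lemma det_scale_rows_poly:
  fixes w :: "nat \<Rightarrow> real" and P :: "nat \<Rightarrow> nat \<Rightarrow> real poly"
  shows "det (mat R R (\<lambda>(i, j). w i * poly (P i j) x)) =
    (\<Prod>i<R. w i) * poly (det (mat R R (\<lambda>(i, j). P i j))) x"
proof -
  have *: "(\<Prod>i = 0..<R. mat R R (\<lambda>(i, j). w i * poly (P i j) x) $$ (i, p i)) =
      (\<Prod>i<R. w i) * poly (\<Prod>i = 0..<R. mat R R (\<lambda>(i, j). P i j) $$ (i, p i)) x"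
    if "p permutes {0..<R}" for p
  proof -
    have "p i < R" if "i < R" for i
      using permutes_in_image[OF \<open>p permutes {0..<R}\<close>, of i] that by simp
    then show ?thesis
      by (simp add: poly_prod atLeast0LessThan flip: prod.distrib)
  qed
  show ?thesis
    unfolding det_def'[OF mat_carrier] poly_sum poly_mult sum_distrib_left
    by (intro sum.cong refl) (subst *, simp_all add: sign_def)
qed

lemma exc_laguerre_is_poly: "\<exists>p. \<forall>x. poly p x = exc_laguerre a lam mu n x"
proof -
  define fs where "fs = seed_functions a lam mu @
    [laguerre a (n + length lam - (sum_list lam + sum_list mu))]"
  define R where "R = length lam + length mu + 1"
  define E where "E = {length lam..<length lam + length mu}"
  have len: "length fs = R"
    by (simp add: fs_def seed_functions_def R_def del: upt_Suc)
  have "\<exists>q. \<forall>x. (deriv ^^ j) (fs ! i) x = (if i \<in> E then exp x else 1) * poly q x"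
    if "i < R" for i j
  proof (cases "i \<in> E")
    case True
    define m where "m = shifted_part mu (i - length lam + 1)"
    have fsi: "fs ! i = (\<lambda>x. exp x * laguerre a m (- x))"
      using True by (auto simp: fs_def seed_functions_def E_def nth_append m_def simp del: upt_Suc)
    obtain p where p: "\<And>x. laguerre a m x = poly p x"
      using laguerre_is_poly by blast
    have "fs ! i = (\<lambda>x. exp x * poly (pcompose p [:0, -1:]) x)"
      unfolding fsi by (simp add: p poly_pcompose)
    then obtain q where "(deriv ^^ j) (fs ! i) = (\<lambda>x. exp x * poly q x)"
      using higher_deriv_exp_poly[of j "pcompose p [:0, -1:]"] by auto
    then show ?thesis
      using True by auto
  next
    case False
    have "\<exists>m. fs ! i = laguerre a m"
    proof (cases "i < length lam")
      case True
      then show ?thesis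
        by (auto simp: fs_def seed_functions_def nth_append simp del: upt_Suc)
    next
      case 2: False
      then have "i = length (seed_functions a lam mu)"
        using False that by (auto simp: seed_functions_def E_def R_def simp del: upt_Suc)
      then show ?thesis
        by (auto simp: fs_def)
    qed
    then obtain m where m: "fs ! i = laguerre a m" ..
    obtain p where "\<forall>x. laguerre a m x = poly p x"
      using laguerre_is_poly by blast
    then have "fs ! i = poly p"
      by (auto simp: m)
    then show ?thesis
      using False by (auto simp: higher_deriv_poly)
  qed
  then obtain P where P: "\<And>i j x. i < R \<Longrightarrow>
      (deriv ^^ j) (fs ! i) x = (if i \<in> E then exp x else 1) * poly (P i j) x"
    by metis
  have "exc_laguerre a lam mu n x = poly (det (mat R R (\<lambda>(i, j). P i j))) x" for x
  proof -
    have "wronskian fs x =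
        det (mat R R (\<lambda>(i, j). (if i \<in> E then exp x else 1) * poly (P i j) x))"
      unfolding wronskian_def len by (intro arg_cong[of _ _ det] eq_matI) (auto simp: P)
    also have "\<dots> = (\<Prod>i<R. if i \<in> E then exp x else 1) *
        poly (det (mat R R (\<lambda>(i, j). P i j))) x"
      by (rule det_scale_rows_poly)
    also have "(\<Prod>i<R. if i \<in> E then exp x else 1) = (\<Prod>i\<in>{..<R} \<inter> E. exp x)"
      by (rule prod.inter_restrict [symmetric]) simp
    also have "{..<R} \<inter> E = E"
      by (auto simp: E_def R_def)
    also have "(\<Prod>i\<in>E. exp x) = exp (real (length mu) * x)"
      by (simp add: E_def exp_of_nat_mult)
    finally show ?thesis
      by (simp add: exc_laguerre_def fs_def flip: mult.assoc exp_add)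
  qed
  then show ?thesis by (intro exI[of _ "det (mat R R (\<lambda>(i, j). P i j))"]) simp
qed

lemma poly_exc_laguerre_poly: "poly (exc_laguerre_poly a lam mu n) x = exc_laguerre a lam mu n x"
proof -
  have "\<exists>!p. \<forall>x. poly p x = exc_laguerre a lam mu n x"
    using exc_laguerre_is_poly by (metis poly_eq_poly_eq_iff ext)
  from theI'[OF this] show ?thesis
    by (simp add: exc_laguerre_poly_def)
qed

end

theory Submission
  imports Defs
begin

text \<open>
  No orthogonality is used.  Expanding the Wronskian along its last row and reducing the
  derivatives of \<open>g = L\<^sub>s\<close> by the Laguerre equation gives \<open>x\<^sup>r P\<^sub>n = U g + V g'\<close>, where the degree
  of \<open>V\<close> is bounded independently of \<open>n\<close>.  By Rolle's theorem \<open>P\<^sub>n\<close> has a zero between two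
  consecutive zeros of \<open>g\<close> unless \<open>V\<close> has one, and Sturm comparison applied to
  \<open>w'' + (-1/4 + (2s+a+1)/(2x) + (1-a\<^sup>2)/(4x\<^sup>2)) w = 0\<close> counts the zeros of \<open>g\<close> in a rescaled
  interval.  This bounds the number of zeros of \<open>P\<^sub>n\<close> in any interval from below by the
  Marchenko-Pastur law.  As \<open>P\<^sub>n\<close> has degree at most \<open>s + const\<close> and the limit law has mass 1, no zeros
  can be missing; applying the lower bound to \<open>C + f\<close> and \<open>C - f\<close> gives the limit.
\<close>

section \<open>Laguerre polynomials\<close>

text \<open>The natural weight has the squared Wronskian of the seed functions in its denominator,
  and that Wronskian may vanish on the positive axis; so only zeros forced by those of
  \<open>g\<close> are within reach, which is one-sided information. The constants come from
  rescaling x = s y: the potential tends to 1/y - 1/4, positive exactly for 0 < y < 4, and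
  comparison with a sine of frequency k = sqrt (1/y - 1/4) gives zeros at spacing at most pi / k,
  that is density at least k / pi = sqrt ((4 - y) / y) / (2 pi). Two obstacles shape the rest. The
  scale N(n) is itself unknown, so the counting is done for any scale asymptotic to s; it is used
  with s + 1 and the constant function 1, which yields N(n) ~ s, and then with N(n). And
  \<open>P\<^sub>n\<close> must not vanish identically, for otherwise there are no zeros to count.
  This is where the degree sequence enters: it makes L_s different from the seed functions, so that
  their independence makes the Wronskian nonzero.\<close>

definition laguerre_poly :: "real \<Rightarrow> nat \<Rightarrow> real poly" where
  "laguerre_poly a n = (\<Sum>k\<le>n. monom (((real n + a) gchoose (n - k)) * (-1) ^ k / fact k) k)"

lemma coeff_laguerre_poly:
  "coeff (laguerre_poly a n) k =
    (if k \<le> n then ((real n + a) gchoose (n - k)) * (-1) ^ k / fact k else 0)"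
  by (auto simp: laguerre_poly_def coeff_sum if_distrib[of "\<lambda>x. _ * x"] sum.delta)

lemma poly_laguerre_poly: "poly (laguerre_poly a n) x = laguerre a n x"
  by (simp add: laguerre_poly_def laguerre_def poly_sum poly_monom power_minus[of x] mult.assoc)

text \<open>The top coefficient is (-1)^n / n!, free of \<open>a\<close>, so the degree drops for no
  real parameter. Distinct indices therefore give distinct degrees, the source of the linear
  independence used below.\<close>

lemma degree_laguerre_poly [simp]: "degree (laguerre_poly a n) = n"
proof (rule antisym)
  show "degree (laguerre_poly a n) \<le> n"
    by (rule degree_le) (simp add: coeff_laguerre_poly)
  show "n \<le> degree (laguerre_poly a n)"
    by (rule le_degree) (simp add: coeff_laguerre_poly)
qed

lemma laguerre_poly_neq_0 [simp]: "laguerre_poly a n \<noteq> 0"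
proof
  assume "laguerre_poly a n = 0"
  then have "coeff (laguerre_poly a n) n = 0" by simp
  then show False by (simp add: coeff_laguerre_poly)
qed

text \<open>The Laguerre equation read off coefficientwise; it comes from the absorption identity
  for generalised binomials. The factor \<open>real k + a + 1\<close> stays on the left because it
  vanishes for some \<open>k\<close> when \<open>a\<close> is a negative integer.\<close>

lemma coeff_laguerre_poly_Suc:
  "real (Suc k) * (real k + a + 1) * coeff (laguerre_poly a n) (Suc k) =
    (real k - real n) * coeff (laguerre_poly a n) k"
proof (cases "k < n")
  case True
  define j where "j = n - Suc k"
  have nk: "n - k = Suc j" "real n = real j + real k + 1"
    using True by (auto simp: j_def)
  have "real (Suc j) * ((real n + a) gchoose Suc j) = (real n + a - real j) * ((real n + a) gchoose j)"
    using gbinomial_mult_1[of "real n + a" j] by (simp only: left_diff_distrib)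
  then have *: "(real n - real k) * ((real n + a) gchoose (n - k)) =
      (real k + a + 1) * ((real n + a) gchoose (n - Suc k))"
    unfolding nk j_def[symmetric] by (simp add: add_ac)
  have "real (Suc k) * (real k + a + 1) * coeff (laguerre_poly a n) (Suc k) =
    - (((real k + a + 1) * ((real n + a) gchoose (n - Suc k))) * (-1) ^ k / fact k)"
    using True by (simp add: coeff_laguerre_poly field_simps del: of_nat_Suc)
  also have "\<dots> = (real k - real n) * coeff (laguerre_poly a n) k"
    using True unfolding * [symmetric] by (simp add: coeff_laguerre_poly field_simps)
  finally show ?thesis .
qed (auto simp: coeff_laguerre_poly)

lemma laguerre_poly_ode:
  "[:0, 1:] * pderiv (pderiv (laguerre_poly a n)) =
    - ([:a + 1, -1:] * pderiv (laguerre_poly a n) + Polynomial.smult (real n) (laguerre_poly a n))"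
proof (rule poly_eqI)
  fix k
  have "real k * real (Suc k) * coeff (laguerre_poly a n) (Suc k) =
    - ((a + 1) * (real (Suc k) * coeff (laguerre_poly a n) (Suc k)) -
       real k * coeff (laguerre_poly a n) k + real n * coeff (laguerre_poly a n) k)"
    using coeff_laguerre_poly_Suc[of k a n] by (simp add: algebra_simps)
  then show "coeff ([:0, 1:] * pderiv (pderiv (laguerre_poly a n))) k =
    coeff (- ([:a + 1, -1:] * pderiv (laguerre_poly a n) +
      Polynomial.smult (real n) (laguerre_poly a n))) k"
    by (cases k) (simp_all add: coeff_pderiv)
qed

text \<open>The ODE reduces every derivative to a combination of \<open>g\<close> and \<open>g'\<close>; the degree of the
  second coefficient is bounded independently of the index of the Laguerre polynomial.\<close>

lemma laguerre_poly_higher_deriv: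
  "\<exists>U V. [:0, 1:] ^ i * (pderiv ^^ i) (laguerre_poly a n) =
      U * laguerre_poly a n + V * pderiv (laguerre_poly a n) \<and> degree U \<le> i \<and> degree V \<le> i"
proof (induction i)
  case 0
  show ?case by (intro exI[of _ 1] exI[of _ 0]) simp
next
  case (Suc i)
  define g where "g = laguerre_poly a n"
  define h where "h = (pderiv ^^ i) g"
  define X where "X = ([:0, 1:] :: real poly)"
  define A where "A = [:a + 1, -1:]"
  obtain U V where UV: "X ^ i * h = U * g + V * pderiv g" and deg: "degree U \<le> i" "degree V \<le> i"
    using Suc unfolding g_def h_def X_def by blast
  have ode: "X * pderiv (pderiv g) = - (A * pderiv g + [:real n:] * g)"
    using laguerre_poly_ode[of a n] by (simp add: X_def A_def g_def)
  have X': "pderiv X = 1" by (simp add: X_def pderiv_pCons)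
  have i: "X * pderiv (X ^ i) = [:real i:] * X ^ i"
    by (cases i) (simp, simp only: pderiv_power_Suc X', simp)
  have "pderiv (X ^ i * h) = pderiv (U * g + V * pderiv g)"
    by (simp only: UV)
  \<comment> \<open>Multiplying by \<open>X\<close> makes both awkward terms reducible:
    \<open>X * pderiv (X ^ i)\<close> is a multiple of \<open>X ^ i\<close>, to which the induction
    hypothesis applies, and \<open>X * pderiv (pderiv g)\<close> is given by the equation.\<close>
  then have "X * (X ^ i * pderiv h + pderiv (X ^ i) * h) =
      X * (U * pderiv g + pderiv U * g + V * pderiv (pderiv g) + pderiv V * pderiv g)"
    by (simp only: pderiv_mult pderiv_add) (simp only: ac_simps)
  also have "\<dots> = X * U * pderiv g + X * pderiv U * g + V * (X * pderiv (pderiv g)) +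
      X * pderiv V * pderiv g"
    by (simp only: algebra_simps)
  finally have *: "X * (X ^ i * pderiv h + pderiv (X ^ i) * h) = X * U * pderiv g +
      X * pderiv U * g + V * (X * pderiv (pderiv g)) + X * pderiv V * pderiv g" .
  have **: "X ^ Suc i * pderiv h = X * U * pderiv g + X * pderiv U * g +
      V * (- (A * pderiv g + [:real n:] * g)) + X * pderiv V * pderiv g -
      [:real i:] * (U * g + V * pderiv g)"
  proof -
    have "X * (X ^ i * pderiv h + pderiv (X ^ i) * h) = X ^ Suc i * pderiv h + (X * pderiv (X ^ i)) * h"
      by (simp only: distrib_left power_Suc mult.assoc)
    also have "(X * pderiv (X ^ i)) * h = [:real i:] * (U * g + V * pderiv g)"
      unfolding i mult.assoc UV ..
    finally show ?thesis using * unfolding ode by (simp only: eq_diff_eq)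
  qed
  \<comment> \<open>The index \<open>n\<close> enters only as a scalar factor, which keeps the
    degree bounds free of it.\<close>
  define U' where "U' = X * pderiv U - [:real n:] * V - [:real i:] * U"
  define V' where "V' = X * U + X * pderiv V - A * V - [:real i:] * V"
  have "X ^ Suc i * pderiv h = U' * g + V' * pderiv g"
    unfolding ** U'_def V'_def by (simp only: algebra_simps mult_minus_right minus_add_distrib)
  moreover have dX: "degree (X * p) \<le> Suc (degree p)" for p
    by (rule order_trans[OF degree_mult_le]) (simp add: X_def)
  have dX': "degree (X * pderiv p) \<le> degree p" for p
  proof (cases "degree p = 0")
    case True
    then have "pderiv p = 0" by (simp add: pderiv_eq_0_iff)
    then show ?thesis by simp
  next
    case False
    then show ?thesis using dX[of "pderiv p"] by (simp add: degree_pderiv)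
  qed
  have "degree (A * V) \<le> Suc (degree V)"
    by (rule order_trans[OF degree_mult_le]) (simp add: A_def)
  then have "degree (A * V) \<le> Suc i" "degree (X * U) \<le> Suc i" "degree (X * pderiv V) \<le> Suc i"
    "degree (X * pderiv U) \<le> Suc i" "degree ([:real i:] * U) \<le> Suc i"
    "degree ([:real i:] * V) \<le> Suc i" "degree ([:real n:] * V) \<le> Suc i"
    using deg dX[of U] dX'[of V] dX'[of U] degree_smult_le[of "real i" U]
      degree_smult_le[of "real i" V] degree_smult_le[of "real n" V]
    by (simp_all del: degree_smult_eq)
  then have "degree U' \<le> Suc i" "degree V' \<le> Suc i"
    unfolding U'_def V'_def by (auto intro!: degree_diff_le degree_add_le)
  ultimately show ?case
    unfolding g_def h_def X_def by auto
qed

section \<open>Counting zeros\<close>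

text \<open>Comparison with sin (k (x - c)), the solution of y'' + k^2 y = 0 that has the two ends
  of the interval as consecutive zeros.\<close>

lemma sturm_zero:
  fixes w w' q :: "real \<Rightarrow> real"
  assumes k: "k > 0"
    and w: "\<And>x. x \<in> {c..c + pi / k} \<Longrightarrow> (w has_real_derivative w' x) (at x)"
    and w': "\<And>x. x \<in> {c..c + pi / k} \<Longrightarrow> (w' has_real_derivative - q x * w x) (at x)"
    and q: "\<And>x. x \<in> {c..c + pi / k} \<Longrightarrow> q x > k\<^sup>2"
  shows "\<exists>x\<in>{c<..<c + pi / k}. w x = 0"
proof (rule ccontr)
  assume no: "\<not> ?thesis"
  define d where "d = c + pi / k"
  have cd: "c < d" using k by (simp add: d_def)
  have contw: "continuous_on {c..d} w"
    using w by (intro DERIV_continuous_on[where D = w']) (auto simp: d_def intro: has_field_derivative_at_within)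
  have contw': "continuous_on {c..d} w'"
    using w' by (intro DERIV_continuous_on[where D = "\<lambda>x. - q x * w x"])
      (auto simp: d_def intro: has_field_derivative_at_within)
  have nz: "w x \<noteq> 0" if "x \<in> {c<..<d}" for x
    using no that by (auto simp: d_def)
  define m where "m = (c + d) / 2"
  have m: "m \<in> {c<..<d}" using cd by (simp add: m_def field_simps)
  define e where "e = sgn (w m)"
  have e: "e = 1 \<or> e = -1" using nz[OF m] by (auto simp: e_def sgn_if)
  have pos: "e * w x > 0" if x: "x \<in> {c<..<d}" for x
  proof (rule ccontr)
    assume neg: "\<not> ?thesis"
    have "continuous_on (closed_segment x m) (\<lambda>x. e * w x)"
      using x m by (intro continuous_intros continuous_on_subset[OF contw])
        (auto simp: closed_segment_eq_real_ivl split: if_splits)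
    moreover have "e * w m > 0" using nz[OF m] by (simp add: e_def sgn_mult_self_eq abs_sgn_eq sgn_if)
    ultimately have "\<exists>y\<in>closed_segment x m. e * w y = 0"
      using neg by (intro IVT'_closed_segment_real[where f = "\<lambda>x. e * w x"]) (auto simp: closed_segment_eq_real_ivl)
    then show False using nz x m e by (auto simp: closed_segment_eq_real_ivl split: if_splits)
  qed
  have pos': "e * w x \<ge> 0" if "x \<in> {c..d}" for x
  proof -
    have "x \<in> closure {c<..<d}" using that cd by simp
    moreover have "continuous_on (closure {c<..<d}) (\<lambda>x. e * w x)"
      using cd by (auto intro!: continuous_intros contw)
    ultimately show ?thesis
      using continuous_ge_on_closure[of "{c<..<d}" "\<lambda>x. e * w x" x 0] pos by force
  qed
  \<comment> \<open>The Wronskian expression of \<open>w\<close> and the sine, normalised by the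
    sign \<open>e\<close> of \<open>w\<close>. Its derivative (k^2 - q) e w sin is negative inside,
    while at the ends, where the sine vanishes, it is nonpositive at \<open>c\<close> and
    nonnegative at \<open>d\<close>.\<close>
  define H where "H = (\<lambda>x. e * (w' x * sin (k * (x - c)) - k * w x * cos (k * (x - c))))"
  have "H d < H c"
  proof (rule DERIV_neg_imp_decreasing_open[OF cd])
    show "continuous_on {c..d} H"
      unfolding H_def by (intro continuous_intros contw contw')
    fix x assume x: "c < x" "x < d"
    then have "(H has_real_derivative (k\<^sup>2 - q x) * (e * w x) * sin (k * (x - c))) (at x)"
      unfolding H_def
      by (auto intro!: derivative_eq_intros w w' simp: d_def algebra_simps power2_eq_square)
    moreover have "sin (k * (x - c)) > 0"
      using x k by (intro sin_gt_zero) (auto simp: d_def field_simps)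
    then have "(k\<^sup>2 - q x) * (e * w x) * sin (k * (x - c)) < 0"
      using q[of x] pos[of x] x by (intro mult_neg_pos mult_neg_pos) (auto simp: d_def)
    ultimately show "\<exists>y. (H has_real_derivative y) (at x) \<and> y < 0" by blast
  qed
  moreover have "H c = - k * (e * w c)" by (simp add: H_def)
  moreover have "H d = k * (e * w d)" using k by (simp add: H_def d_def)
  ultimately show False
    using k pos'[of c] pos'[of d] cd by (smt (verit) atLeastAtMost_iff mult_minus_left mult_nonneg_nonneg)
qed

text \<open>The Liouville substitution w = x^((a+1)/2) e^(-x/2) g removes the first-order term of
  the Laguerre equation; the hypothesis bounds the resulting potential from below. The factor is
  positive for x > 0, so \<open>w\<close> and \<open>g\<close> have the same zeros there.\<close>

lemma laguerre_poly_zero_between: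
  assumes c: "c > 0" and k: "k > 0"
    and q: "\<And>x. x \<in> {c..c + pi / k} \<Longrightarrow>
      k\<^sup>2 < (2 * real n + a + 1) / (2 * x) - 1 / 4 + (1 - a\<^sup>2) / (4 * x\<^sup>2)"
  shows "\<exists>x\<in>{c<..<c + pi / k}. poly (laguerre_poly a n) x = 0"
proof -
  define g where "g = laguerre_poly a n"
  define \<phi> where "\<phi> = (\<lambda>x :: real. x powr ((a + 1) / 2) * exp (- x / 2))"
  \<comment> \<open>The logarithmic derivative of \<open>\<phi>\<close>. Since 2 l = (a + 1)/x - 1
    is the coefficient of g' in the equation divided by x, the first-order terms cancel in
    w''.\<close>
  define l where "l = (\<lambda>x. (a + 1) / (2 * x) - 1 / 2)"
  define w' where "w' = (\<lambda>x. \<phi> x * (poly (pderiv g) x + l x * poly g x))"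
  define Q where "Q = (\<lambda>x. (2 * real n + a + 1) / (2 * x) - 1 / 4 + (1 - a\<^sup>2) / (4 * x\<^sup>2))"
  have \<phi>: "(\<phi> has_real_derivative \<phi> x * l x) (at x)" if "x > 0" for x
  proof -
    have e: "(a + 1) / 2 = (a - 1) / 2 + 1" by (simp add: field_simps)
    have "x powr ((a + 1) / 2) = x powr ((a - 1) / 2) * x"
      unfolding e powr_add using that by simp
    then show ?thesis
      unfolding \<phi>_def l_def using that
      by (auto intro!: derivative_eq_intros simp: field_simps)
  qed
  have l: "(l has_real_derivative - (a + 1) / (2 * x\<^sup>2)) (at x)" if "x > 0" for x
    unfolding l_def using that
    by (auto intro!: derivative_eq_intros simp: field_simps power2_eq_square)
  have "\<exists>x\<in>{c<..<c + pi / k}. \<phi> x * poly g x = 0"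
  proof (rule sturm_zero[OF k])
    fix x assume x: "x \<in> {c..c + pi / k}"
    then have x0: "x > 0" using c by simp
    show "((\<lambda>x. \<phi> x * poly g x) has_real_derivative w' x) (at x)"
      unfolding w'_def by (auto intro!: derivative_eq_intros \<phi> x0 poly_DERIV simp: algebra_simps)
    have "poly ([:0, 1:] * pderiv (pderiv g)) x =
        poly (- ([:a + 1, -1:] * pderiv g + Polynomial.smult (real n) g)) x"
      unfolding g_def laguerre_poly_ode ..
    then have ode: "poly (pderiv (pderiv g)) x =
        - (2 * l x * poly (pderiv g) x + real n / x * poly g x)"
      using x0 by (simp add: l_def field_simps)
    have Q: "l x ^ 2 - (a + 1) / (2 * x\<^sup>2) - real n / x = - Q x"
      using x0 by (simp add: l_def Q_def field_simps power2_eq_square)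
    have "(w' has_real_derivative \<phi> x * l x * (poly (pderiv g) x + l x * poly g x) +
        \<phi> x * (poly (pderiv (pderiv g)) x + (- (a + 1) / (2 * x\<^sup>2) * poly g x +
          l x * poly (pderiv g) x))) (at x)"
      unfolding w'_def by (auto intro!: derivative_eq_intros \<phi> l x0 poly_DERIV simp: algebra_simps)
    also have "\<phi> x * l x * (poly (pderiv g) x + l x * poly g x) +
        \<phi> x * (poly (pderiv (pderiv g)) x + (- (a + 1) / (2 * x\<^sup>2) * poly g x +
          l x * poly (pderiv g) x)) =
        (l x ^ 2 - (a + 1) / (2 * x\<^sup>2) - real n / x) * (\<phi> x * poly g x)"
      unfolding ode
      by (simp add: algebra_simps power2_eq_square add_divide_distrib diff_divide_distrib)
    finally show "(w' has_real_derivative - Q x * (\<phi> x * poly g x)) (at x)"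
      unfolding Q .
    show "k\<^sup>2 < Q x" using q[OF x] by (simp add: Q_def)
  qed
  then show ?thesis using c by (auto simp: \<phi>_def g_def)
qed

text \<open>Rolle's theorem for \<open>g \<cdot> exp (\<integral> U / V)\<close>, whose derivative vanishes exactly where
  \<open>U g + V g'\<close> does.\<close>

lemma zero_of_combination_between:
  fixes g U V :: "real poly"
  assumes xy: "x < y" and gx: "poly g x = 0" and gy: "poly g y = 0"
    and V: "\<And>z. z \<in> {x..y} \<Longrightarrow> poly V z \<noteq> 0"
  shows "\<exists>z\<in>{x<..<y}. poly (U * g + V * pderiv g) z = 0"
proof -
  have "continuous_on {x..y} (\<lambda>z. poly U z / poly V z)"
    using V by (intro continuous_intros) auto
  then obtain I where I: "\<And>z. z \<in> {x..y} \<Longrightarrow>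
      (I has_vector_derivative poly U z / poly V z) (at z within {x..y})"
    by (rule antiderivative_continuous) blast
  define G where "G = (\<lambda>z. poly g z * exp (I z))"
  have contI: "continuous_on {x..y} I"
    using I by (meson continuous_on_eq_continuous_within has_vector_derivative_continuous)
  have G': "(G has_real_derivative (poly (pderiv g) z + poly U z / poly V z * poly g z) * exp (I z)) (at z)"
    if z: "x < z" "z < y" for z
  proof -
    have "(I has_real_derivative poly U z / poly V z) (at z within {x..y})"
      using I[of z] z by (simp add: has_real_derivative_iff_has_vector_derivative)
    then have "(I has_real_derivative poly U z / poly V z) (at z)"
      using z by (simp add: at_within_Icc_at)
    then show ?thesis unfolding G_def
      by (auto intro!: derivative_eq_intros poly_DERIV simp: algebra_simps)
  qed
  obtain z where z: "x < z" "z < y" "(G has_real_derivative 0) (at z)"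
  proof (rule exE[OF Rolle[OF xy, of G]])
    show "G x = G y" by (simp add: G_def gx gy)
    show "continuous_on {x..y} G" unfolding G_def by (intro continuous_intros contI)
    show "G differentiable (at z)" if "x < z" "z < y" for z
      using G'[OF that] by (auto simp: real_differentiable_def)
  qed (use that in auto)
  from DERIV_unique[OF z(3) G'[OF z(1,2)]] have "poly (pderiv g) z + poly U z / poly V z * poly g z = 0"
    by simp
  then have "poly (U * g + V * pderiv g) z = 0"
    using V[of z] z by (simp add: field_simps)
  then show ?thesis using z by auto
qed

text \<open>Every gap between successive \<open>y i\<close> contains a zero of \<open>P\<close>
  unless it meets a zero of \<open>V\<close>. A zero of \<open>V\<close> spoils at most two closed
  gaps, namely when it is their common endpoint; hence \<open>2 * K\<close>. As \<open>c\<close> is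
  nonnegative, x^r does not vanish on the open interval and can be cancelled.\<close>

lemma card_zeros_ge:
  fixes P U V g :: "real poly"
  assumes P: "P \<noteq> 0" "[:0, 1:] ^ r * P = U * g + V * pderiv g" and V: "degree V \<le> K"
    and y: "\<And>i. i < m \<Longrightarrow> y i < y (Suc i)"
    and y0: "\<And>i. i \<le> m \<Longrightarrow> poly g (y i) = 0" "\<And>i. i \<le> m \<Longrightarrow> y i \<in> {c<..<d}" and c: "c \<ge> 0"
  shows "m \<le> card {z\<in>{c<..<d}. poly P z = 0} + 2 * K"
proof -
  define Z where "Z = {z\<in>{c<..<d}. poly P z = 0}"
  have finZ: "finite Z"
    using poly_roots_finite[OF P(1)] by (auto simp: Z_def)
  have Z: "z \<in> Z" if "z \<in> {c<..<d}" "poly (U * g + V * pderiv g) z = 0" for z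
    using that c by (auto simp: Z_def simp flip: P(2))
  have ymono: "y i \<le> y j" if "i \<le> j" "j \<le> m" for i j
    using that
  proof (induction j)
    case (Suc j)
    then show ?case using y[of j] by (cases "i = Suc j") auto
  qed simp
  show ?thesis
  proof (cases "V = 0")
    \<comment> \<open>If \<open>V\<close> vanishes identically, the zeros of \<open>g\<close> are
      themselves zeros of \<open>P\<close>, and Rolle's theorem is not involved.\<close>
    case True
    have inj: "inj_on y {..m}"
    proof (rule linorder_inj_onI)
      fix i j assume ij: "i < j" "j \<in> {..m}"
      then have "y i < y (Suc i)" "y (Suc i) \<le> y j" by (auto intro!: y ymono)
      then show "y i \<noteq> y j" by simp
    qed auto
    have "y ` {..m} \<subseteq> Z"
      using y0 True by (auto intro!: Z)
    then have "card (y ` {..m}) \<le> card Z" by (intro card_mono finZ)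
    then show ?thesis using card_image[OF inj] by (simp add: Z_def)
  next
    case False
    define B where "B = {i. i < m \<and> (\<exists>v\<in>{y i..y (Suc i)}. poly V v = 0)}"
    define G where "G = {..<m} - B"
    have disj: "i = j" if "i < m" "j < m" "z \<in> {y i<..y (Suc i)}" "z \<in> {y j<..y (Suc j)}" for i j z
    proof (rule ccontr)
      assume "i \<noteq> j"
      then consider "Suc i \<le> j" | "Suc j \<le> i" by linarith
      then show False
        using ymono[of "Suc i" j] ymono[of "Suc j" i] that by cases auto
    qed
    have "\<exists>z. z \<in> {y i<..<y (Suc i)} \<and> z \<in> Z" if "i \<in> G" for i
    proof -
      have i: "i < m" using that by (simp add: G_def)
      obtain z where z: "z \<in> {y i<..<y (Suc i)}" "poly (U * g + V * pderiv g) z = 0"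
      proof (rule bexE[OF zero_of_combination_between[of "y i" "y (Suc i)" g V U]])
        show "poly V z \<noteq> 0" if "z \<in> {y i..y (Suc i)}" for z
          using \<open>i \<in> G\<close> that i unfolding G_def B_def by blast
      qed (use y[OF i] y0[of i] y0[of "Suc i"] i in auto)
      then have "z \<in> Z" using y0(2)[of i] y0(2)[of "Suc i"] i by (intro Z) auto
      with z show ?thesis by blast
    qed
    then obtain \<zeta> where \<zeta>: "\<And>i. i \<in> G \<Longrightarrow> \<zeta> i \<in> {y i<..<y (Suc i)}" "\<And>i. i \<in> G \<Longrightarrow> \<zeta> i \<in> Z"
      by metis
    have "inj_on \<zeta> G"
    proof (rule inj_onI)
      fix i j assume "i \<in> G" "j \<in> G" "\<zeta> i = \<zeta> j"
      then show "i = j" using \<zeta>(1)[of i] \<zeta>(1)[of j] by (intro disj[of i j "\<zeta> i"]) (auto simp: G_def)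
    qed
    then have cG: "card G \<le> card Z"
      using \<zeta>(2) by (intro card_inj_on_le[OF _ _ finZ]) auto
    define R where "R = {v. poly V v = 0}"
    have finR: "finite R" unfolding R_def by (rule poly_roots_finite[OF False])
    have cR: "card R \<le> K"
      unfolding R_def using card_poly_roots_bound[OF False] V by simp
    obtain \<nu> where \<nu>: "\<And>i. i \<in> B \<Longrightarrow> \<nu> i \<in> {y i..y (Suc i)}" "\<And>i. i \<in> B \<Longrightarrow> \<nu> i \<in> R"
    proof -
      have "\<forall>i\<in>B. \<exists>v. v \<in> {y i..y (Suc i)} \<and> v \<in> R" by (auto simp: B_def R_def)
      from bchoice[OF this] show ?thesis using that by blast
    qed
    \<comment> \<open>The Boolean tells whether the zero is the left end of its gap. A zero shared
      by two gaps is the right end of one and the left end of the other, so the pair determines the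
      gap.\<close>
    have "inj_on (\<lambda>i. (\<nu> i, \<nu> i = y i)) B"
    proof (rule inj_onI)
      fix i j assume ij: "i \<in> B" "j \<in> B" "(\<nu> i, \<nu> i = y i) = (\<nu> j, \<nu> j = y j)"
      then have m: "i < m" "j < m" by (auto simp: B_def)
      show "i = j"
      proof (cases "\<nu> i = y i")
        case True
        show ?thesis
        proof (rule ccontr)
          assume "i \<noteq> j"
          then consider "Suc i \<le> j" | "Suc j \<le> i" by linarith
          then show False
            using ymono[of "Suc i" j] ymono[of "Suc j" i] y[of i] y[of j] ij m True by cases auto
        qed
      next
        case False
        then show ?thesis
          using ij m \<nu>(1)[of i] \<nu>(1)[of j] by (intro disj[of i j "\<nu> i"]) auto
      qed
    qed
    moreover have "(\<lambda>i. (\<nu> i, \<nu> i = y i)) ` B \<subseteq> R \<times> UNIV" using \<nu> by auto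
    ultimately have "card B \<le> card (R \<times> (UNIV :: bool set))"
      by (intro card_inj_on_le finite_cartesian_product finR) auto
    then have "card B \<le> 2 * K" using cR by (simp add: card_cartesian_product)
    moreover have "m = card B + card G"
    proof -
      have "B \<union> G = {..<m}" "B \<inter> G = {}" by (auto simp: B_def G_def)
      then show ?thesis by (metis card_Un_disjoint card_lessThan finite_Un finite_lessThan)
    qed
    ultimately show ?thesis using cG by (simp add: Z_def)
  qed
qed

text \<open>Equals k / pi for k^2 = 1/x - 1/4, the rescaled potential. At 0 the value is 0 by the
  convention for division, and for x < 0 or x > 4 it is negative because \<open>sqrt\<close> is odd;
  only arguments in [0,4] are meaningful.\<close>

definition mp_density :: "real \<Rightarrow> real" where
  "mp_density x = sqrt ((4 - x) / x) / (2 * pi)"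

text \<open>The limit 1/y - 1/4 of the potential at x = c n * y decreases in y, so on the interval
  it is smallest at the right end; this is why \<kappa> is compared with
  \<open>mp_density v\<close>. Cells slightly shorter than 1/\<kappa> then each contain a zero of
  the Laguerre polynomial. The scale \<open>c\<close> is only asymptotic to \<open>s\<close>, so
  that different scales can be inserted.\<close>

lemma eventually_card_zeros_ge:
  fixes s :: "nat \<Rightarrow> nat" and c :: "nat \<Rightarrow> real" and P :: "nat \<Rightarrow> real poly"
  assumes P: "eventually (\<lambda>n. P n \<noteq> 0) F"
    and UV: "\<And>n. \<exists>U V. [:0, 1:] ^ r * P n =
        U * laguerre_poly a (s n) + V * pderiv (laguerre_poly a (s n)) \<and> degree V \<le> K"
    and s: "filterlim (\<lambda>n. real (s n)) at_top F"
    and cs: "((\<lambda>n. c n / real (s n)) \<longlongrightarrow> 1) F"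
    and uv: "0 < u" "u < v" "v < 4" and \<kappa>: "0 < \<kappa>" "\<kappa> < mp_density v"
  shows "eventually (\<lambda>n. c n * ((v - u) * \<kappa>) \<le>
      real (card {z\<in>{c n * u<..<c n * v}. poly (P n) z = 0})) F"
proof -
  \<comment> \<open>The room between \<kappa> and \<kappa>' absorbs all bounded losses in the
    count.\<close>
  obtain \<kappa>' where \<kappa>': "\<kappa> < \<kappa>'" "\<kappa>' < mp_density v" using dense[OF \<kappa>(2)] by blast
  have \<kappa>'0: "\<kappa>' > 0" using \<kappa> \<kappa>' by simp
  define k where "k = pi * \<kappa>'"
  have k: "k > 0" "pi / k = 1 / \<kappa>'" using \<kappa>'0 by (simp_all add: k_def)
  have "k < sqrt ((4 - v) / v) / 2"
    using \<kappa>'(2) by (simp add: k_def mp_density_def field_simps)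
  then have "k\<^sup>2 < (sqrt ((4 - v) / v) / 2)\<^sup>2"
    using k(1) by (intro power_strict_mono) auto
  then have k2: "k\<^sup>2 < 1 / v - 1 / 4"
    using uv by (simp add: power_divide diff_divide_distrib)
  have dense: "eventually (\<lambda>n. Z < f n) F" if "filterlim f at_top F" for f :: "nat \<Rightarrow> real" and Z
    using that by (simp add: filterlim_at_top_dense)
  have s0: "eventually (\<lambda>n. real (s n) > 0) F" by (rule dense[OF s])
  have "filterlim (\<lambda>n. c n / real (s n) * real (s n)) at_top F"
    by (rule filterlim_tendsto_pos_mult_at_top[OF cs _ s]) simp
  then have c: "filterlim c at_top F"
    by (rule filterlim_mono_eventually[OF _ order_refl order_refl])
      (use s0 in \<open>auto elim: eventually_mono\<close>)
  have sc: "((\<lambda>n. real (s n) / c n) \<longlongrightarrow> 1) F"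
    using tendsto_inverse[OF cs] by simp
  have ic: "((\<lambda>n. 1 / c n) \<longlongrightarrow> 0) F"
    using tendsto_inverse_0_at_top[OF c] by (simp add: inverse_eq_divide)
  \<comment> \<open>A lower bound for the potential on the whole rescaled interval: the 1/x term is
    taken at the right end, the modulus of the 1/x^2 term at the left end.\<close>
  define qmin where "qmin = (\<lambda>n. (2 * real (s n) + a + 1) / (2 * (c n * v)) - 1 / 4 -
    \<bar>1 - a\<^sup>2\<bar> / (4 * (c n * u)\<^sup>2))"
  have "((\<lambda>n. (real (s n) / c n) / v + (a + 1) / (2 * v) * (1 / c n) - 1 / 4 -
      \<bar>1 - a\<^sup>2\<bar> / (4 * u\<^sup>2) * (1 / c n)\<^sup>2) \<longlongrightarrow>
      1 / v + (a + 1) / (2 * v) * 0 - 1 / 4 - \<bar>1 - a\<^sup>2\<bar> / (4 * u\<^sup>2) * 0\<^sup>2) F"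
    using uv by (intro tendsto_intros sc ic) auto
  moreover have "(\<lambda>n. (real (s n) / c n) / v + (a + 1) / (2 * v) * (1 / c n) - 1 / 4 -
      \<bar>1 - a\<^sup>2\<bar> / (4 * u\<^sup>2) * (1 / c n)\<^sup>2) = qmin"
    by (simp add: qmin_def fun_eq_iff power_mult_distrib power_divide add_divide_distrib mult_ac)
  ultimately have "(qmin \<longlongrightarrow> 1 / v - 1 / 4) F" by simp
  then have q: "eventually (\<lambda>n. k\<^sup>2 < qmin n) F"
    using k2 by (rule order_tendstoD)
  have "filterlim (\<lambda>n. c n * ((v - u) * (\<kappa>' - \<kappa>))) at_top F"
    using filterlim_tendsto_pos_mult_at_top[OF tendsto_const _ c, of "(v - u) * (\<kappa>' - \<kappa>)"] uv \<kappa>'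
    by (simp add: mult.commute)
  \<comment> \<open>The losses: 2 K gaps to zeros of \<open>V\<close>, one cell to rounding, and one
    because m + 1 zeros bound only m gaps.\<close>
  then have big: "eventually (\<lambda>n. real (2 * K + 2) < c n * ((v - u) * (\<kappa>' - \<kappa>))) F"
    by (rule dense)
  have c0: "eventually (\<lambda>n. c n > 0) F" by (rule dense[OF c])
  \<comment> \<open>For negative \<open>a\<close> the number 2 s + a + 1 may be positive only
    eventually; its sign makes the 1/x term decreasing.\<close>
  have "filterlim (\<lambda>n. 2 * real (s n)) at_top F"
    by (rule filterlim_tendsto_pos_mult_at_top[OF tendsto_const _ s]) simp
  then have sa: "eventually (\<lambda>n. - (a + 1) < 2 * real (s n)) F"
    by (rule dense)
  show ?thesis
    using P q big c0 sa
  proof eventually_elim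
    case (elim n)
    define C where "C = c n"
    have C: "C > 0" using elim by (simp add: C_def)
    define M where "M = nat \<lfloor>C * ((v - u) * \<kappa>')\<rfloor>"
    have M1: "real M \<le> C * ((v - u) * \<kappa>')" "C * ((v - u) * \<kappa>') < real M + 1"
      using C uv \<kappa>'0 by (simp_all add: M_def)
    have M2: "C * ((v - u) * \<kappa>) + real (2 * K + 2) < C * ((v - u) * \<kappa>')"
      using elim by (simp add: C_def algebra_simps)
    have "C * ((v - u) * \<kappa>) > 0" using C uv \<kappa> by simp
    then have "M > 0" using M1 M2 by (cases M) auto
    then obtain m where m: "M = Suc m" by (cases M) auto
    have zero: "\<exists>z\<in>{C * u + real i / \<kappa>'<..<C * u + real (Suc i) / \<kappa>'}. poly (laguerre_poly a (s n)) z = 0"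
      and le: "C * u + real (Suc i) / \<kappa>' \<le> C * v" if "i \<le> m" for i
    proof -
      have "real (Suc i) \<le> C * ((v - u) * \<kappa>')" using that M1(1) m by linarith
      then have "real (Suc i) / \<kappa>' \<le> C * (v - u)" using \<kappa>'0 by (simp add: field_simps)
      then show le: "C * u + real (Suc i) / \<kappa>' \<le> C * v" by (simp add: algebra_simps)
      have e: "C * u + real (Suc i) / \<kappa>' = (C * u + real i / \<kappa>') + pi / k"
        by (simp add: k add_divide_distrib)
      show "\<exists>z\<in>{C * u + real i / \<kappa>'<..<C * u + real (Suc i) / \<kappa>'}. poly (laguerre_poly a (s n)) z = 0"
        unfolding e
      proof (rule laguerre_poly_zero_between[OF _ k(1)])
        show "0 < C * u + real i / \<kappa>'" using C uv \<kappa>'0 by (intro add_pos_nonneg) auto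
        fix x assume "x \<in> {C * u + real i / \<kappa>'..C * u + real i / \<kappa>' + pi / k}"
        then have "C * u + real i / \<kappa>' \<le> x" and xv: "x \<le> C * v" using le e by auto
        moreover have "0 \<le> real i / \<kappa>'" using \<kappa>'0 by simp
        ultimately have xu: "C * u \<le> x" by linarith
        have Cu: "0 < C * u" using C uv by simp
        have x0: "0 < x" using xu Cu by linarith
        have "k\<^sup>2 < qmin n" using elim by simp
        also have "qmin n \<le> (2 * real (s n) + a + 1) / (2 * x) - 1 / 4 + (1 - a\<^sup>2) / (4 * x\<^sup>2)"
        proof -
          have "(2 * real (s n) + a + 1) / (2 * (C * v)) \<le> (2 * real (s n) + a + 1) / (2 * x)"
            using xv x0 C uv elim by (intro divide_left_mono mult_pos_pos) auto
          moreover have "\<bar>1 - a\<^sup>2\<bar> / (4 * x\<^sup>2) \<le> \<bar>1 - a\<^sup>2\<bar> / (4 * (C * u)\<^sup>2)"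
            using xu Cu x0 by (intro divide_left_mono mult_left_mono power_mono mult_pos_pos) auto
          moreover have "- \<bar>1 - a\<^sup>2\<bar> / (4 * x\<^sup>2) \<le> (1 - a\<^sup>2) / (4 * x\<^sup>2)"
            by (intro divide_right_mono) auto
          ultimately show ?thesis by (simp add: qmin_def C_def)
        qed
        finally show "k\<^sup>2 < (2 * real (s n) + a + 1) / (2 * x) - 1 / 4 + (1 - a\<^sup>2) / (4 * x\<^sup>2)" .
      qed
    qed
    have "\<exists>z. \<forall>i\<in>{..m}. z i \<in> {C * u + real i / \<kappa>'<..<C * u + real (Suc i) / \<kappa>'} \<and>
        poly (laguerre_poly a (s n)) (z i) = 0"
      using zero by (intro bchoice) blast
    then obtain y where y: "\<And>i. i \<le> m \<Longrightarrow> y i \<in> {C * u + real i / \<kappa>'<..<C * u + real (Suc i) / \<kappa>'}"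
      "\<And>i. i \<le> m \<Longrightarrow> poly (laguerre_poly a (s n)) (y i) = 0" by auto
    obtain U V where UV': "[:0, 1:] ^ r * P n =
        U * laguerre_poly a (s n) + V * pderiv (laguerre_poly a (s n))" "degree V \<le> K"
      using UV by blast
    have "m \<le> card {z\<in>{C * u<..<C * v}. poly (P n) z = 0} + 2 * K"
    proof (rule card_zeros_ge[OF elim(1) UV'])
      show "y i < y (Suc i)" if "i < m" for i
        using y(1)[of i] y(1)[of "Suc i"] that by auto
      show "y i \<in> {C * u<..<C * v}" if "i \<le> m" for i
      proof -
        have "0 \<le> real i / \<kappa>'" using \<kappa>'0 by simp
        then show ?thesis using y(1)[OF that] le[OF that] by auto
      qed
      show "0 \<le> C * u" using C uv by simp
    qed (use y in auto)
    from of_nat_mono[OF this, where 'a = real]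
    have "real m \<le> real (card {z\<in>{C * u<..<C * v}. poly (P n) z = 0}) + 2 * real K"
      by simp
    then show ?case using M1 M2 m by (simp add: C_def)
  qed
qed

section \<open>The Marchenko-Pastur law\<close>

text \<open>The primitive \<open>G\<close> comes from the substitution x = 4 sin^2 t, which turns
  the integrand into (4/pi) cos^2 t. The density is unbounded at 0, so \<open>G\<close> is
  differentiated only in the interior and is merely continuous at the ends.\<close>

lemma mp_density_has_integral: "(mp_density has_integral 1) {0..4}"
proof -
  define G where "G = (\<lambda>x. (sqrt (x * (4 - x)) + 4 * arcsin (sqrt x / 2)) / (2 * pi))"
  have "(mp_density has_integral G 4 - G 0) {0..4}"
  proof (rule fundamental_theorem_of_calculus_interior)
    have "sqrt x / 2 \<le> 1" if "x \<le> 4" for x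
      using real_sqrt_le_mono[OF that] by simp
    then show "continuous_on {0..4} G"
      unfolding G_def by (intro continuous_intros) (auto intro: order_trans[of _ 0])
  next
    fix x :: real assume x: "x \<in> {0<..<4}"
    define s t where "s = sqrt x" and "t = sqrt (4 - x)"
    have st: "s > 0" "t > 0" "s\<^sup>2 = x" "t\<^sup>2 = 4 - x" using x by (auto simp: s_def t_def)
    have "s < 2" using real_sqrt_less_mono[of x 4] x by (simp add: s_def)
    have sq: "sqrt (1 - (s / 2)\<^sup>2) = t / 2"
      using st by (intro real_sqrt_unique) (auto simp: power_divide field_simps)
    have sxt: "sqrt (x * (4 - x)) = s * t" by (simp add: s_def t_def real_sqrt_mult)
    have "(G has_real_derivative ((4 - 2 * x) / (2 * (s * t)) +
        4 * (1 / (t / 2) * (1 / (2 * s) / 2))) / (2 * pi)) (at x)"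
      unfolding G_def using x \<open>s > 0\<close> \<open>s < 2\<close>
      by (auto intro!: derivative_eq_intros simp: sxt[symmetric] sq[symmetric] s_def[symmetric] field_simps)
    also have "((4 - 2 * x) / (2 * (s * t)) + 4 * (1 / (t / 2) * (1 / (2 * s) / 2))) / (2 * pi) = mp_density x"
    proof -
      have "(4 - 2 * x) / (2 * (s * t)) + 4 * (1 / (t / 2) * (1 / (2 * s) / 2)) = (t\<^sup>2) / (s * t)"
      proof -
        have x_eq: "x = 4 - t\<^sup>2" using st by simp
        show ?thesis unfolding x_eq using st(1,2) by (simp add: field_simps)
      qed
      also have "\<dots> = t / s" using st(1,2) by (simp add: power2_eq_square)
      finally show ?thesis by (simp add: mp_density_def s_def t_def real_sqrt_divide)
    qed
    finally show "(G has_vector_derivative mp_density x) (at x)"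
      by (simp add: has_real_derivative_iff_has_vector_derivative)
  qed simp
  moreover have "G 4 - G 0 = 1" by (simp add: G_def)
  ultimately show ?thesis by simp
qed

lemma mp_density_pos: "0 < x \<Longrightarrow> x < 4 \<Longrightarrow> 0 < mp_density x"
  by (simp add: mp_density_def)

lemma mp_density_nonneg: "0 \<le> x \<Longrightarrow> x \<le> 4 \<Longrightarrow> 0 \<le> mp_density x"
  by (simp add: mp_density_def)

lemma isCont_mp_density: "0 < x \<Longrightarrow> isCont mp_density x"
  unfolding mp_density_def by (intro continuous_intros) auto

text \<open>Nothing is known about \<open>f\<close> at 0, where it need not even have a limit.
  Domination by \<open>C * mp_density\<close> on the open interval suffices, the endpoints being
  negligible.\<close>

lemma mult_mp_density_integrable:
  assumes "continuous_on {0<..} f" and bd: "\<And>x. x > 0 \<Longrightarrow> \<bar>f x\<bar> \<le> C"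
  shows "(\<lambda>x. f x * mp_density x) integrable_on {0..4}"
proof -
  have "(\<lambda>x. f x * mp_density x) integrable_on {0<..<4}"
  proof (rule measurable_bounded_by_integrable_imp_integrable)
    have "continuous_on {0<..<4} (\<lambda>x. f x * mp_density x)"
      by (intro continuous_intros continuous_on_subset[OF assms(1)]
          continuous_at_imp_continuous_on ballI isCont_mp_density) auto
    then show "(\<lambda>x. f x * mp_density x) \<in> borel_measurable (lebesgue_on {0<..<4})"
      by (rule continuous_imp_measurable_on_sets_lebesgue) simp
    have "mp_density integrable_on {0<..<4}"
      using mp_density_has_integral by (metis has_integral_integrable integrable_on_open_interval_real)
    then show "(\<lambda>x. C * mp_density x) integrable_on {0<..<4}"
      by (rule integrable_on_mult_right)
    show "norm (f x * mp_density x) \<le> C * mp_density x" if "x \<in> {0<..<4}" for x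
      using bd[of x] mp_density_nonneg[of x] that by (auto simp: abs_mult intro: mult_right_mono)
  qed simp
  then show ?thesis by (metis integrable_on_open_interval_real)
qed

lemma sum_mset_nonneg:
  fixes f :: "'a \<Rightarrow> real"
  shows "(\<And>x. x \<in># A \<Longrightarrow> 0 \<le> f x) \<Longrightarrow> 0 \<le> (\<Sum>x\<in>#A. f x)"
  by (induction A) auto

text \<open>Only lower bounds for the number of points in intervals are assumed.  They suffice
  because \<open>f\<close> is nonnegative, so that neither the points near the ends of the support
  nor those outside of it have to be controlled.\<close>

lemma eventually_sum_ge_mp_integral:
  fixes X :: "nat \<Rightarrow> real multiset" and c :: "nat \<Rightarrow> real" and f :: "real \<Rightarrow> real"
  assumes count: "\<And>u v \<kappa>. 0 < u \<Longrightarrow> u < v \<Longrightarrow> v < 4 \<Longrightarrow> 0 < \<kappa> \<Longrightarrow> \<kappa> < mp_density v \<Longrightarrow>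
      eventually (\<lambda>n. c n * ((v - u) * \<kappa>) \<le> real (size {#x \<in># X n. u < x \<and> x < v#})) F"
    and c: "eventually (\<lambda>n. 0 \<le> c n) F"
    and X: "\<And>n x. x \<in># X n \<Longrightarrow> x > 0"
    and f: "continuous_on {0<..} f" "\<And>x. x > 0 \<Longrightarrow> 0 \<le> f x" "\<And>x. x > 0 \<Longrightarrow> f x \<le> C"
    and \<epsilon>: "\<epsilon> > 0"
  shows "eventually (\<lambda>n. c n * (integral {0..4} (\<lambda>x. f x * mp_density x) - \<epsilon>) \<le>
      (\<Sum>x\<in>#X n. f x)) F"
proof -
  define h where "h = (\<lambda>x. f x * mp_density x)"
  have hint: "h integrable_on {0..4}"
    unfolding h_def using f by (intro mult_mp_density_integrable[of f C]) auto
  have hint': "h integrable_on {u..v}" if "0 \<le> u" "v \<le> 4" for u v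
    by (rule integrable_on_subinterval[OF hint]) (use that in auto)
  \<comment> \<open>One half of \<epsilon> pays for the bisection, whose total error is at most
    \<open>\<epsilon>' * 4\<close>; the other half pays for the two ends that are cut off.\<close>
  define \<epsilon>' where "\<epsilon>' = \<epsilon> / 8"
  have \<epsilon>': "\<epsilon>' > 0" using \<epsilon> by (simp add: \<epsilon>'_def)
  define S where "S = (\<lambda>u v n. \<Sum>x\<in>#{#x \<in># X n. u < x \<and> x < v#}. f x)"
  \<comment> \<open>The error is proportional to the length of the interval, hence additive under
    concatenation. So the claim follows by bisection from short intervals around each point.\<close>
  define P where "P = (\<lambda>u v. 0 < u \<longrightarrow> u \<le> v \<longrightarrow> v < 4 \<longrightarrow>
      eventually (\<lambda>n. c n * (integral {u..v} h - \<epsilon>' * (v - u)) \<le> S u v n) F)"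
  have S_nonneg: "0 \<le> S u v n" for u v n
    unfolding S_def using X f(2) by (intro sum_mset_nonneg) auto
  have P: "P u v" if uv: "0 < u" "u \<le> v" "v < 4" for u v
    using uv(2)
  proof (induction rule: Bolzano)
    case (trans p q r)
    show ?case unfolding P_def
    proof (intro impI)
      assume *: "0 < p" "p \<le> r" "r < 4"
      have "eventually (\<lambda>n. c n * (integral {p..q} h - \<epsilon>' * (q - p)) \<le> S p q n) F"
        "eventually (\<lambda>n. c n * (integral {q..r} h - \<epsilon>' * (r - q)) \<le> S q r n) F"
        using trans * by (auto simp: P_def)
      then show "eventually (\<lambda>n. c n * (integral {p..r} h - \<epsilon>' * (r - p)) \<le> S p r n) F"
      proof eventually_elim
        case (elim n)
        \<comment> \<open>Points equal to \<open>q\<close> lie in neither open interval. Omitting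
          them only lowers the sum, since \<open>f\<close> is nonnegative.\<close>
        have "{#x \<in># X n. p < x \<and> x < q#} + {#x \<in># X n. q < x \<and> x < r#} \<subseteq># {#x \<in># X n. p < x \<and> x < r#}"
          using trans(3,4) by (auto simp: subseteq_mset_def)
        then obtain Y where Y: "{#x \<in># X n. p < x \<and> x < r#} =
            {#x \<in># X n. p < x \<and> x < q#} + {#x \<in># X n. q < x \<and> x < r#} + Y"
          by (metis subset_mset.le_iff_add)
        have "(\<Sum>x\<in>#Y. f x) \<ge> 0"
        proof (rule sum_mset_nonneg)
          fix x assume "x \<in># Y"
          then have "x \<in># {#x \<in># X n. p < x \<and> x < r#}" unfolding Y by simp
          then show "0 \<le> f x" using X[of x n] f(2) by auto
        qed
        then have "S p q n + S q r n \<le> S p r n"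
          unfolding S_def Y by simp
        moreover have I: "integral {p..q} h + integral {q..r} h = integral {p..r} h"
          using trans(3,4) * by (intro Henstock_Kurzweil_Integration.integral_combine hint') auto
        have "c n * (integral {p..r} h - \<epsilon>' * (r - p)) =
            c n * (integral {p..q} h - \<epsilon>' * (q - p)) + c n * (integral {q..r} h - \<epsilon>' * (r - q))"
          unfolding I[symmetric] by (simp add: algebra_simps)
        ultimately show ?case using elim by linarith
      qed
    qed
  next
    case (local x)
    then have x: "0 < x" "x < 4" using uv by auto
    \<comment> \<open>The first bound keeps \<kappa> positive; the second makes the product of the
      lowered values \<open>f x - \<eta>\<close> and \<open>mp_density x - \<eta>\<close> fall short
      of \<open>h x\<close> by at most \<epsilon>'/2. The truncation at 0 in \<open>m\<close> allows
      multiplying a lower bound for the count by \<open>m\<close>.\<close>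
    define \<eta> where "\<eta> = min (mp_density x / 2) (\<epsilon>' / (2 * (f x + mp_density x + 1)))"
    have dx: "mp_density x > 0" using mp_density_pos x by simp
    have fx: "f x \<ge> 0" using f(2) x by simp
    have \<eta>: "\<eta> > 0" using dx fx \<epsilon>' by (auto simp: \<eta>_def)
    define \<kappa> where "\<kappa> = mp_density x - \<eta>"
    define m where "m = max 0 (f x - \<eta>)"
    have "\<eta> \<le> mp_density x / 2" unfolding \<eta>_def by (rule min.cobounded1)
    then have \<kappa>: "\<kappa> > 0" using dx by (simp add: \<kappa>_def)
    have "\<eta> * (f x + mp_density x + 1) \<le> \<epsilon>' / 2"
    proof -
      have "\<eta> \<le> \<epsilon>' / (2 * (f x + mp_density x + 1))" unfolding \<eta>_def by (rule min.cobounded2)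
      then show ?thesis using dx fx by (simp add: field_simps)
    qed
    moreover have "m * \<kappa> \<ge> (f x - \<eta>) * \<kappa>" using \<kappa> by (intro mult_right_mono) (auto simp: m_def)
    moreover have "(f x - \<eta>) * \<kappa> = h x - \<eta> * (f x + mp_density x + 1) + (\<eta> + \<eta> * \<eta>)"
      by (simp add: \<kappa>_def h_def algebra_simps)
    moreover have "0 \<le> \<eta> + \<eta> * \<eta>" using \<eta> by simp
    ultimately have m\<kappa>: "m * \<kappa> \<ge> h x - \<epsilon>' / 2" by linarith
    have contf: "isCont f x"
      using f(1) x by (simp add: continuous_on_eq_continuous_at open_greaterThan)
    have conth: "isCont h x"
      unfolding h_def using x by (intro continuous_intros contf isCont_mp_density)
    have "eventually (\<lambda>y. 0 < y \<and> y < 4 \<and> f x - \<eta> < f y \<and> \<kappa> < mp_density y \<and> h y < h x + \<epsilon>' / 2) (nhds x)"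
    proof (intro eventually_conj)
      have "eventually (\<lambda>y. y \<in> {0<..<4}) (nhds x)"
        using x by (intro eventually_nhds_in_open) auto
      then show "eventually (\<lambda>y. 0 < y) (nhds x)" "eventually (\<lambda>y. y < 4) (nhds x)"
        by (auto elim: eventually_mono)
      show "eventually (\<lambda>y. f x - \<eta> < f y) (nhds x)"
        using contf \<eta> by (intro order_tendstoD(1)[of f "f x"]) (auto simp: isCont_def tendsto_at_iff_tendsto_nhds)
      show "eventually (\<lambda>y. \<kappa> < mp_density y) (nhds x)"
        using isCont_mp_density[of x] x \<eta>
        by (intro order_tendstoD(1)[of mp_density "mp_density x"])
          (auto simp: \<kappa>_def isCont_def tendsto_at_iff_tendsto_nhds)
      show "eventually (\<lambda>y. h y < h x + \<epsilon>' / 2) (nhds x)"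
        using conth \<epsilon>' by (intro order_tendstoD(2)[of h "h x"]) (auto simp: isCont_def tendsto_at_iff_tendsto_nhds)
    qed
    then obtain d where d: "d > 0" "\<And>y. \<bar>y - x\<bar> < d \<Longrightarrow>
        0 < y \<and> y < 4 \<and> f x - \<eta> < f y \<and> \<kappa> < mp_density y \<and> h y < h x + \<epsilon>' / 2"
      unfolding eventually_nhds_metric dist_real_def by blast
    have "P p q" if pq: "p \<le> x" "x \<le> q" "q - p < d" for p q
      unfolding P_def
    proof (intro impI)
      assume *: "0 < p" "p \<le> q" "q < 4"
      have D: "0 < y \<and> y < 4 \<and> f x - \<eta> < f y \<and> \<kappa> < mp_density y \<and> h y < h x + \<epsilon>' / 2"
        if "y \<in> {p..q}" for y
        using that pq by (intro d(2)) auto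
      show "eventually (\<lambda>n. c n * (integral {p..q} h - \<epsilon>' * (q - p)) \<le> S p q n) F"
      proof (cases "p = q")
        case True
        then show ?thesis using S_nonneg by simp
      next
        case False
        then have "p < q" using * by simp
        have "integral {p..q} h \<le> integral {p..q} (\<lambda>_. h x + \<epsilon>' / 2)"
          using D * by (intro integral_le hint') (auto intro: less_imp_le)
        then have "integral {p..q} h - \<epsilon>' * (q - p) \<le> (q - p) * (h x - \<epsilon>' / 2)"
          using * by (simp add: field_simps)
        also have "\<dots> \<le> (q - p) * (m * \<kappa>)"
          using m\<kappa> * by (intro mult_left_mono) auto
        finally have le: "integral {p..q} h - \<epsilon>' * (q - p) \<le> (q - p) * (m * \<kappa>)" .
        have "eventually (\<lambda>n. c n * ((q - p) * \<kappa>) \<le> real (size {#x \<in># X n. p < x \<and> x < q#})) F"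
          using \<open>p < q\<close> * D[of q] \<kappa> by (intro count) auto
        then show ?thesis
          using c
        proof eventually_elim
          case (elim n)
          have "c n * (integral {p..q} h - \<epsilon>' * (q - p)) \<le> c n * ((q - p) * (m * \<kappa>))"
            using elim le by (intro mult_left_mono)
          also have "\<dots> = m * (c n * ((q - p) * \<kappa>))" by simp
          also have "\<dots> \<le> m * real (size {#x \<in># X n. p < x \<and> x < q#})"
            using elim by (intro mult_left_mono) (auto simp: m_def)
          also have "\<dots> = (\<Sum>x\<in>#{#x \<in># X n. p < x \<and> x < q#}. m)"
            by (simp add: mult.commute)
          also have "\<dots> \<le> S p q n"
            unfolding S_def
          proof (rule sum_mset_mono)
            fix y assume "y \<in># {#x \<in># X n. p < x \<and> x < q#}"
            then show "m \<le> f y" using D[of y] X[of y n] f(2)[of y] by (auto simp: m_def)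
          qed
          finally show ?case .
        qed
      qed
    qed
    then show ?case using d(1) by blast
  qed
  \<comment> \<open>Bisection only covers compact subintervals of (0,4); continuity of the
    indefinite integral makes the remaining ends negligible.\<close>
  have "((\<lambda>\<delta>. integral {0..4 - \<delta>} h - integral {0..\<delta>} h) \<longlongrightarrow> integral {0..4 - 0} h - integral {0..0} h) (at_right 0)"
  proof (intro tendsto_diff)
    have cont: "continuous_on {0..4} (\<lambda>x. integral {0..x} h)"
      by (rule indefinite_integral_continuous_1[OF hint])
    have ev: "eventually (\<lambda>\<delta>::real. \<delta> \<in> {0<..<4}) (at_right 0)"
      by (rule eventually_at_right_real) simp
    show "((\<lambda>\<delta>. integral {0..4 - \<delta>} h) \<longlongrightarrow> integral {0..4 - 0} h) (at_right 0)"
      by (rule continuous_on_tendsto_compose[OF cont])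
        (auto intro!: tendsto_eq_intros eventually_mono[OF ev])
    show "((\<lambda>\<delta>. integral {0..\<delta>} h) \<longlongrightarrow> integral {0..0} h) (at_right 0)"
      by (rule continuous_on_tendsto_compose[OF cont])
        (auto intro!: tendsto_eq_intros eventually_mono[OF ev])
  qed
  then have "eventually (\<lambda>\<delta>. integral {0..4} h - \<epsilon> / 2 < integral {0..4 - \<delta>} h - integral {0..\<delta>} h) (at_right 0)"
    by (rule order_tendstoD) (use \<epsilon> in auto)
  moreover have "eventually (\<lambda>\<delta>::real. \<delta> \<in> {0<..<1}) (at_right 0)"
    by (rule eventually_at_right_real) simp
  ultimately have "eventually (\<lambda>\<delta>. \<delta> \<in> {0<..<1} \<and>
      integral {0..4} h - \<epsilon> / 2 < integral {0..4 - \<delta>} h - integral {0..\<delta>} h) (at_right 0)"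
    by eventually_elim simp
  then obtain \<delta> where \<delta>: "0 < \<delta>" "\<delta> < 1"
    "integral {0..4} h - \<epsilon> / 2 < integral {0..4 - \<delta>} h - integral {0..\<delta>} h"
    using eventually_happens[of _ "at_right (0::real)"] by auto
  have "integral {0..\<delta>} h + integral {\<delta>..4 - \<delta>} h = integral {0..4 - \<delta>} h"
    using \<delta> by (intro Henstock_Kurzweil_Integration.integral_combine hint') auto
  moreover have "\<epsilon>' * (4 - \<delta> - \<delta>) \<le> \<epsilon>' * 4"
    using \<delta> \<epsilon>' by (intro mult_left_mono) auto
  moreover have "\<epsilon>' * 4 = \<epsilon> / 2" by (simp add: \<epsilon>'_def)
  ultimately have I: "integral {0..4} h - \<epsilon> \<le> integral {\<delta>..4 - \<delta>} h - \<epsilon>' * (4 - \<delta> - \<delta>)"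
    using \<delta>(3) by linarith
  have "eventually (\<lambda>n. c n * (integral {\<delta>..4 - \<delta>} h - \<epsilon>' * (4 - \<delta> - \<delta>)) \<le> S \<delta> (4 - \<delta>) n) F"
    using P[of \<delta> "4 - \<delta>"] \<delta> by (simp add: P_def)
  then show ?thesis
    using c
  proof eventually_elim
    case (elim n)
    have "c n * (integral {0..4} h - \<epsilon>) \<le> c n * (integral {\<delta>..4 - \<delta>} h - \<epsilon>' * (4 - \<delta> - \<delta>))"
      using I elim by (intro mult_left_mono)
    also have "\<dots> \<le> S \<delta> (4 - \<delta>) n" using elim by simp
    also have "\<dots> \<le> S \<delta> (4 - \<delta>) n + (\<Sum>x\<in>#{#x \<in># X n. \<not> (\<delta> < x \<and> x < 4 - \<delta>)#}. f x)"
      using X f(2) by (auto intro!: sum_mset_nonneg)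
    also have "\<dots> = (\<Sum>x\<in>#X n. f x)"
      unfolding S_def sum_mset.union[symmetric] image_mset_union[symmetric]
        multiset_partition[symmetric] ..
    finally show ?case unfolding h_def .
  qed
qed

section \<open>Wronskians and linear dependence\<close>

lemma differentiable_prod_real:
  fixes f :: "'i \<Rightarrow> real \<Rightarrow> real"
  assumes "\<And>i. i \<in> S \<Longrightarrow> (f i) differentiable (at x)"
  shows "(\<lambda>x. \<Prod>i\<in>S. f i x) differentiable (at x)"
  using assms by (induction S rule: infinite_finite_induct) auto

lemma differentiable_det:
  fixes e :: "nat \<Rightarrow> nat \<Rightarrow> real \<Rightarrow> real"
  assumes "\<And>i j. i < n \<Longrightarrow> j < n \<Longrightarrow> e i j differentiable (at x)"
  shows "(\<lambda>x. det (mat n n (\<lambda>(i, j). e i j x))) differentiable (at x)"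
proof -
  have *: "(\<Prod>i = 0..<n. mat n n (\<lambda>(i, j). e i j x) $$ (i, p i)) = (\<Prod>i = 0..<n. e i (p i) x)"
    if "p permutes {0..<n}" for p x
    using permutes_in_image[OF that] by (intro prod.cong) auto
  have "(\<lambda>x. det (mat n n (\<lambda>(i, j). e i j x))) =
      (\<lambda>x. \<Sum>p\<in>{p. p permutes {0..<n}}. of_int (sign p) * (\<Prod>i = 0..<n. e i (p i) x))"
    unfolding det_def'[OF mat_carrier]
    by (intro ext sum.cong) (simp_all add: * sign_def)
  moreover have "\<dots> differentiable (at x)"
  proof (intro differentiable_sum ballI differentiable_mult differentiable_prod_real)
    fix p i assume "p \<in> {p. p permutes {0..<n}}" "i \<in> {0..<n}"
    then have "p i < n" "i < n" using permutes_in_image[of p "{0..<n}" i] by auto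
    then show "e i (p i) differentiable (at x)" by (rule assms[rotated])
  qed (auto simp: finite_permutations)
  ultimately show ?thesis by simp
qed

text \<open>The coefficients \<open>c\<close> are quotients of cofactors of the last column.  Differentiating
  the relations \<open>\<Sum>i. c i * f\<^sub>i\<^sup>(\<^sup>j\<^sup>) = 0\<close> shows that their derivatives solve a
  homogeneous system whose determinant is the Wronskian of all functions but the last.\<close>

lemma wronskian_zero_imp_dependent:
  fixes fs :: "(real \<Rightarrow> real) list"
  assumes "\<And>i j x. i < length fs \<Longrightarrow>
      ((deriv ^^ j) (fs ! i) has_real_derivative (deriv ^^ Suc j) (fs ! i) x) (at x)"
    and "l < u" and "\<And>x. x \<in> {l<..<u} \<Longrightarrow> wronskian fs x = 0"
  shows "\<exists>l' u' c. l' < u' \<and> (\<exists>i<length fs. c i \<noteq> 0) \<and>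
      (\<forall>x\<in>{l'<..<u'}. (\<Sum>i<length fs. c i * (fs ! i) x) = 0)"
  using assms
proof (induction fs rule: rev_induct)
  case Nil
  \<comment> \<open>The empty determinant is 1, so the hypothesis fails at any point of the
    interval.\<close>
  have "(l + u) / 2 \<in> {l<..<u}" using Nil(2) by simp
  from Nil(3)[OF this] show ?case by (simp add: wronskian_def)
next
  case (snoc g gs)
  define fs where "fs = gs @ [g]"
  define k where "k = length gs"
  have len: "length fs = Suc k" by (simp add: fs_def k_def)
  have gsnth: "gs ! i = fs ! i" if "i < k" for i using that by (simp add: fs_def k_def nth_append)
  define D where "D = (\<lambda>i j. (deriv ^^ j) (fs ! i))"
  have D: "(D i j has_real_derivative D i (Suc j) x) (at x)" if "i \<le> k" for i j x
    using snoc.prems(1)[of i j x] that by (simp add: D_def fs_def k_def)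
  have Ddiff: "D i j differentiable (at x)" if "i \<le> k" for i j x
    using D[OF that] real_differentiable_def by blast
  have Wgs: "wronskian gs x = det (mat k k (\<lambda>(i, j). D i j x))" for x
    unfolding wronskian_def k_def[symmetric]
    by (intro arg_cong[of _ _ det] eq_matI) (auto simp: D_def gsnth)
  show ?case
  proof (cases "\<forall>x\<in>{l<..<u}. wronskian gs x = 0")
    case True
    have "\<exists>l' u' c. l' < u' \<and> (\<exists>i<length gs. c i \<noteq> 0) \<and>
      (\<forall>x\<in>{l'<..<u'}. (\<Sum>i<length gs. c i * (gs ! i) x) = 0)"
    proof (rule snoc.IH)
      fix i j x assume "i < length gs"
      then show "((deriv ^^ j) (gs ! i) has_real_derivative (deriv ^^ Suc j) (gs ! i) x) (at x)"
        using snoc.prems(1)[of i j x] by (simp add: nth_append)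
    qed (use True snoc.prems in auto)
    then obtain l' u' c where c: "l' < u'" "\<exists>i<k. c i \<noteq> 0"
      "\<forall>x\<in>{l'<..<u'}. (\<Sum>i<k. c i * (gs ! i) x) = 0" unfolding k_def by blast
    define c' where "c' = (\<lambda>i. if i < k then c i else 0 :: real)"
    have "(\<Sum>i<Suc k. c' i * (fs ! i) x) = (\<Sum>i<k. c i * (gs ! i) x)" for x
      unfolding sum.lessThan_Suc by (simp add: c'_def) (rule sum.cong, simp_all add: gsnth)
    moreover have "\<exists>i<Suc k. c' i \<noteq> 0" using c(2) by (auto simp: c'_def intro: less_SucI)
    ultimately show ?thesis using c unfolding fs_def[symmetric] len by metis
  next
    case False
    \<comment> \<open>The argument works near a point where the smaller Wronskian is nonzero. For
      general smooth functions a vanishing Wronskian gives dependence only locally, which is why the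
      conclusion allows a smaller interval.\<close>
    then obtain x0 where x0: "x0 \<in> {l<..<u}" "wronskian gs x0 \<noteq> 0" by blast
    have Wdiff: "wronskian gs differentiable (at x)" for x
      unfolding ext[of "wronskian gs", OF Wgs] by (rule differentiable_det) (simp add: Ddiff)
    then obtain e0 where e0: "e0 > 0" "\<And>y. dist x0 y < e0 \<Longrightarrow> wronskian gs y \<noteq> 0"
      using continuous_at_avoid[of x0 "wronskian gs" 0] x0(2) differentiable_imp_continuous_within by blast
    define e where "e = min e0 (min (x0 - l) (u - x0))"
    have e: "e > 0" "ball x0 e \<subseteq> {x\<in>{l<..<u}. wronskian gs x \<noteq> 0}"
      using e0 x0(1) by (auto simp: e_def dist_real_def)
    define J where "J = ball x0 e"
    have J: "J = {x0 - e<..<x0 + e}" by (auto simp: J_def ball_def dist_real_def)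
    have openJ: "open J" and x0J: "x0 \<in> J" using e by (auto simp: J_def)
    have WJ: "wronskian gs x \<noteq> 0" "wronskian fs x = 0" if "x \<in> J" for x
      using e(2) that snoc.prems(3)[of x] by (auto simp: J_def fs_def)
    \<comment> \<open>The Wronskian matrix with its last column replaced by the j-th derivatives.
      For j < k two columns agree, for j = k it is the matrix itself, and the cofactors of the last
      column are the same for all j: this gives all relations at once.\<close>
    define B where "B = (\<lambda>j x. mat (Suc k) (Suc k) (\<lambda>(i, j'). D i (if j' = k then j else j') x))"
    define C where "C = (\<lambda>i x. cofactor (B k x) i k)"
    have Bcof: "cofactor (B j x) i k = C i x" for i j x
    proof -
      have "mat_delete (B j x) i k = mat_delete (B k x) i k"
        by (rule eq_matI) (auto simp: mat_delete_def B_def)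
      then show ?thesis by (simp add: C_def cofactor_def)
    qed
    have Bcarr: "B j x \<in> carrier_mat (Suc k) (Suc k)" for j x by (simp add: B_def)
    have expand: "det (B j x) = (\<Sum>i\<le>k. D i j x * C i x)" for j x
      unfolding laplace_expansion_column[OF Bcarr lessI] Bcof lessThan_Suc_atMost
      by (intro sum.cong) (auto simp: B_def)
    have Bk: "det (B k x) = wronskian fs x" for x
      unfolding wronskian_def len
      by (intro arg_cong[of _ _ det] eq_matI) (auto simp: D_def B_def)
    have Bj: "det (B j x) = 0" if "j < k" for j x
      using that by (intro det_identical_columns[OF Bcarr, of j k]) (auto simp: B_def intro!: eq_vecI)
    have rel: "(\<Sum>i\<le>k. D i j x * C i x) = 0" if "j \<le> k" "x \<in> J" for j x
      using that Bj[of j x] Bk[of x] WJ(2)[of x] expand[of j x] by (cases "j = k") auto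
    have Ck: "C k x = wronskian gs x" for x
    proof -
      have "mat_delete (B k x) k k = mat k k (\<lambda>(i, j). D i j x)"
        by (rule eq_matI) (auto simp: mat_delete_def B_def)
      then show ?thesis by (simp add: C_def cofactor_def Wgs)
    qed
    have Cdiff: "C i differentiable (at x)" if "i \<le> k" for i x
    proof -
      have md: "mat_delete (B k x) i k = mat k k (\<lambda>(i', j'). D (if i' < i then i' else Suc i') j' x)" for x
        by (rule eq_matI) (auto simp: mat_delete_def B_def)
      have "(\<lambda>x. (-1) ^ (i + k) * det (mat k k (\<lambda>(i', j'). D (if i' < i then i' else Suc i') j' x)))
          differentiable (at x)"
        by (intro differentiable_mult differentiable_det) (auto intro!: Ddiff)
      then show ?thesis by (simp add: C_def[abs_def] cofactor_def md)
    qed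
    \<comment> \<open>Dividing by the last cofactor makes \<open>c k\<close> identically 1, so its
      derivative drops out and the differentiated system has only k unknowns.\<close>
    define c where "c = (\<lambda>i x. C i x / C k x)"
    define c' where "c' = (\<lambda>i. deriv (c i))"
    have c': "(c i has_real_derivative c' i x) (at x)" if "i \<le> k" "x \<in> J" for i x
    proof -
      have "c i differentiable (at x)"
        unfolding c_def using that WJ(1) by (intro differentiable_divide Cdiff) (auto simp: Ck)
      then show ?thesis
        unfolding c'_def by (simp add: DERIV_deriv_iff_real_differentiable)
    qed
    have rel': "(\<Sum>i\<le>k. c i x * D i j x) = 0" if "j \<le> k" "x \<in> J" for j x
    proof -
      have "(\<Sum>i\<le>k. c i x * D i j x) = (\<Sum>i\<le>k. D i j x * C i x) / C k x"
        by (simp add: c_def sum_divide_distrib mult.commute)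
      then show ?thesis using rel that by simp
    qed
    have ck: "c k x = 1" if "x \<in> J" for x using WJ(1)[OF that] by (simp add: c_def Ck)
    have zero_deriv: "(f has_real_derivative 0) (at x)" if "\<And>y. y \<in> J \<Longrightarrow> f y = a" "x \<in> J" for f a x
    proof -
      have "((\<lambda>_. a) has_real_derivative 0) (at x)" by simp
      then show ?thesis
        by (rule has_field_derivative_transform_within_open[OF _ openJ \<open>x \<in> J\<close>]) (simp add: that)
    qed
    have c'k: "c' k x = 0" if "x \<in> J" for x
      using DERIV_unique[OF c'[OF order_refl that] zero_deriv[OF ck that]] by simp
    have rel'': "(\<Sum>i<k. c' i x * D i j x) = 0" if "j < k" "x \<in> J" for j x
    proof -
      have "((\<lambda>x. \<Sum>i\<le>k. c i x * D i j x) has_real_derivative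
          (\<Sum>i\<le>k. c' i x * D i j x + c i x * D i (Suc j) x)) (at x)"
        using that by (intro DERIV_sum) (auto intro!: derivative_eq_intros c' D simp: mult.commute)
      moreover have "((\<lambda>x. \<Sum>i\<le>k. c i x * D i j x) has_real_derivative 0) (at x)"
        using that by (intro zero_deriv) (auto intro!: rel')
      ultimately have "(\<Sum>i\<le>k. c' i x * D i j x + c i x * D i (Suc j) x) = 0"
        by (rule DERIV_unique)
      then have "(\<Sum>i\<le>k. c' i x * D i j x) = 0"
        using rel'[of "Suc j" x] that by (simp add: sum.distrib)
      then show ?thesis using c'k that by (simp flip: lessThan_Suc_atMost)
    qed
    have c'0: "c' i x = 0" if "i \<le> k" "x \<in> J" for i x
    proof (cases "i = k")
      case False
      define M where "M = mat k k (\<lambda>(i, j). D i j x)"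
      have Mc: "M \<in> carrier_mat k k" by (simp add: M_def)
      define v where "v = vec k (\<lambda>i. c' i x)"
      have "transpose_mat M *\<^sub>v v = 0\<^sub>v k"
      proof (rule eq_vecI)
        fix j assume "j < dim_vec (0\<^sub>v k :: real Matrix.vec)"
        then have j: "j < k" by simp
        have "Matrix.vec_index (transpose_mat M *\<^sub>v v) j = (\<Sum>i<k. c' i x * D i j x)"
          using j by (auto simp: M_def v_def scalar_prod_def lessThan_atLeast0 mult.commute intro!: sum.cong)
        then show "Matrix.vec_index (transpose_mat M *\<^sub>v v) j = Matrix.vec_index (0\<^sub>v k) j"
          using rel''[OF j that(2)] j by simp
      qed (simp add: M_def)
      moreover have "det (transpose_mat M) \<noteq> 0"
        using WJ(1)[OF that(2)] det_transpose[OF Mc] by (simp add: M_def Wgs)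
      moreover have "v \<in> carrier_vec k" by (simp add: v_def)
      ultimately have "v = 0\<^sub>v k"
        using det_0_iff_vec_prod_zero[of "transpose_mat M" k] Mc by auto
      then have "Matrix.vec_index v i = 0" using False that by simp
      then show ?thesis using False that by (simp add: v_def)
    qed (use c'k that in simp)
    have const: "c i x = c i x0" if "i \<le> k" "x \<in> J" for i x
    proof -
      have "\<exists>a. \<forall>x\<in>J. c i x = a"
        using that c' c'0 unfolding J_def
        by (intro has_field_derivative_zero_constant convex_ball)
          (metis has_field_derivative_at_within)
      then show ?thesis using that x0J by metis
    qed
    have "(\<Sum>i<Suc k. c i x0 * (fs ! i) x) = 0" if "x \<in> J" for x
    proof -
      have "(\<Sum>i<Suc k. c i x0 * (fs ! i) x) = (\<Sum>i\<le>k. c i x * D i 0 x)"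
        unfolding lessThan_Suc_atMost by (intro sum.cong refl) (simp add: D_def const[OF _ that])
      then show ?thesis using rel'[of 0 x] that by simp
    qed
    moreover have "c k x0 \<noteq> 0" using ck[OF x0J] by simp
    ultimately show ?thesis
      unfolding fs_def[symmetric] len using e(1) J
      by (intro exI[of _ "x0 - e"] exI[of _ "x0 + e"] exI[of _ "\<lambda>i. c i x0"]) auto
  qed
qed

section \<open>Linear independence of polynomials and exponential polynomials\<close>

lemma poly_eq_0_on_interval:
  fixes p :: "real poly"
  assumes "l < u" "\<And>x. x \<in> {l<..<u} \<Longrightarrow> poly p x = 0"
  shows "p = 0"
proof (rule ccontr)
  assume "p \<noteq> 0"
  then have "finite {x. poly p x = 0}" by (rule poly_roots_finite)
  then have "finite {l<..<u}" by (rule finite_subset[rotated]) (use assms in auto)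
  then show False using assms(1) infinite_Ioo by blast
qed

lemma poly_add_pderiv_eq_0:
  fixes q :: "real poly"
  assumes "q + pderiv q = 0"
  shows "q = 0"
proof (rule ccontr)
  assume q: "q \<noteq> 0"
  have "coeff (q + pderiv q) (degree q) = lead_coeff q"
    by (simp add: coeff_pderiv coeff_eq_0)
  then show False using q assms by simp
qed

text \<open>Differentiation keeps the form p + e^x q, lowers the degree of \<open>p\<close> and
  sends \<open>q\<close> to q + q'. The latter map is injective, so \<open>q\<close> vanishes by
  induction on the degree of \<open>p\<close>.\<close>

lemma poly_plus_exp_poly_eq_0:
  fixes p q :: "real poly"
  assumes "l < u" "\<And>x. x \<in> {l<..<u} \<Longrightarrow> poly p x + exp x * poly q x = 0"
  shows "p = 0 \<and> q = 0"
  using assms(2)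
proof (induction "degree p" arbitrary: p q rule: less_induct)
  case less
  have "q = 0"
  proof (cases "p = 0")
    case True
    then show ?thesis using less.prems by (intro poly_eq_0_on_interval[OF assms(1)]) simp
  next
    case False
    have deriv: "poly (pderiv p) x + exp x * poly (q + pderiv q) x = 0" if "x \<in> {l<..<u}" for x
    proof -
      have "((\<lambda>x. poly p x + exp x * poly q x) has_real_derivative
          poly (pderiv p) x + exp x * poly (q + pderiv q) x) (at x)"
        by (auto intro!: derivative_eq_intros poly_DERIV simp: algebra_simps)
      moreover have "((\<lambda>x. poly p x + exp x * poly q x) has_real_derivative 0) (at x)"
        by (rule has_field_derivative_transform_within_open[of "\<lambda>_. 0" _ _ "{l<..<u}"])
          (use less.prems that in auto)
      ultimately show ?thesis by (rule DERIV_unique)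
    qed
    have "q + pderiv q = 0"
    proof (cases "degree p = 0")
      case True
      then have "pderiv p = 0" by (simp add: pderiv_eq_0_iff)
      then show ?thesis using deriv by (intro poly_eq_0_on_interval[OF assms(1)]) simp
    next
      case False
      then have "degree (pderiv p) < degree p" by (simp add: degree_pderiv)
      from less.hyps[OF this deriv] show ?thesis by blast
    qed
    then show ?thesis by (rule poly_add_pderiv_eq_0)
  qed
  moreover from this have "p = 0"
    using less.prems by (intro poly_eq_0_on_interval[OF assms(1)]) simp
  ultimately show ?case by simp
qed

lemma distinct_degrees_independent:
  fixes p :: "'i \<Rightarrow> real poly"
  assumes "finite I" and inj: "inj_on (\<lambda>i. degree (p i)) I" and nz: "\<And>i. i \<in> I \<Longrightarrow> p i \<noteq> 0"
    and sum: "(\<Sum>i\<in>I. Polynomial.smult (c i) (p i)) = 0" and "i \<in> I"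
  shows "c i = 0"
proof (rule ccontr)
  assume "c i \<noteq> 0"
  define S where "S = {i\<in>I. c i \<noteq> 0}"
  have S: "finite S" "S \<noteq> {}" using assms \<open>c i \<noteq> 0\<close> by (auto simp: S_def)
  have "Max ((\<lambda>i. degree (p i)) ` S) \<in> (\<lambda>i. degree (p i)) ` S"
    using S by (intro Max_in) auto
  then obtain m where m: "m \<in> S" "degree (p m) = Max ((\<lambda>i. degree (p i)) ` S)" by force
  have less: "degree (p j) < degree (p m)" if "j \<in> S" "j \<noteq> m" for j
  proof -
    have "degree (p j) \<le> degree (p m)" unfolding m(2) using S that by (intro Max_ge) auto
    moreover have "degree (p j) \<noteq> degree (p m)"
      using inj that m(1) by (auto simp: inj_on_def S_def)
    ultimately show ?thesis by simp
  qed
  have "0 = coeff (\<Sum>i\<in>I. Polynomial.smult (c i) (p i)) (degree (p m))" by (simp add: sum)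
  also have "\<dots> = (\<Sum>i\<in>I. c i * coeff (p i) (degree (p m)))" by (simp add: coeff_sum)
  also have "\<dots> = (\<Sum>i\<in>{m}. c i * coeff (p i) (degree (p m)))"
  proof (rule sum.mono_neutral_right)
    show "\<forall>i\<in>I - {m}. c i * coeff (p i) (degree (p m)) = 0"
    proof
      fix i assume "i \<in> I - {m}"
      then show "c i * coeff (p i) (degree (p m)) = 0"
        using less[of i] by (cases "c i = 0") (auto simp: S_def coeff_eq_0)
    qed
  qed (use assms(1) m(1) in \<open>auto simp: S_def\<close>)
  finally show False using nz[of m] m(1) by (auto simp: S_def)
qed

section \<open>Exceptional Laguerre polynomials\<close>

lemma seed_functions_nth_lam:
  "i < length lam \<Longrightarrow>
    seed_functions a lam mu ! i = poly (laguerre_poly a (shifted_part lam (Suc i)))"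
  by (auto simp: seed_functions_def nth_append poly_laguerre_poly simp del: upt_Suc)

lemma seed_functions_nth_mu:
  "i < length mu \<Longrightarrow> seed_functions a lam mu ! (length lam + i) =
    (\<lambda>x. exp x * poly (laguerre_poly a (shifted_part mu (Suc i)) \<circ>\<^sub>p [:0, -1:]) x)"
  by (auto simp: seed_functions_def nth_append poly_laguerre_poly poly_pcompose simp del: upt_Suc)

lemma length_seed_functions: "length (seed_functions a lam mu) = length lam + length mu"
  by (simp add: seed_functions_def del: upt_Suc)

text \<open>The order of quantifiers is the point: the cofactors of the last row involve only the
  seed functions, so one family \<open>A\<close> serves every \<open>n\<close>.\<close>

lemma exc_laguerre_poly_expansion:
  "\<exists>A. \<forall>n. exc_laguerre_poly a lam mu n = (\<Sum>j\<le>length lam + length mu.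
    A j * (pderiv ^^ j) (laguerre_poly a (n + length lam - (sum_list lam + sum_list mu))))"
proof -
  define r where "r = length lam + length mu"
  define E where "E = {length lam..<r}"
  define fs where "fs = seed_functions a lam mu"
  define g where "g = (\<lambda>n. laguerre_poly a (n + length lam - (sum_list lam + sum_list mu)))"
  have len: "length fs = r" by (simp add: fs_def r_def length_seed_functions)
  have "\<exists>q. \<forall>x. (deriv ^^ j) (fs ! i) x = (if i \<in> E then exp x else 1) * poly q x"
    if "i < r" for i j
  proof (cases "i \<in> E")
    case True
    then obtain i' where i': "i = length lam + i'" "i' < length mu"
      using that by (auto simp: E_def r_def dest!: le_Suc_ex)
    then obtain p where "fs ! i = (\<lambda>x. exp x * poly p x)"
      unfolding fs_def using seed_functions_nth_mu by blast
    then show ?thesis using True higher_deriv_exp_poly[of j p] by auto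
  next
    case False
    then have "i < length lam" using that by (auto simp: E_def)
    then obtain p where "fs ! i = poly p"
      unfolding fs_def using seed_functions_nth_lam by blast
    then show ?thesis using False by (auto simp: higher_deriv_poly)
  qed
  then obtain Q where Q: "\<And>i j x. i < r \<Longrightarrow>
      (deriv ^^ j) (fs ! i) x = (if i \<in> E then exp x else 1) * poly (Q i j) x"
    by metis
  \<comment> \<open>The exponential factors of the rows in \<open>E\<close> are stripped off; their
    product is cancelled by the exponential prefactor of the exceptional polynomial.\<close>
  define M where "M = (\<lambda>n. mat (Suc r) (Suc r)
    (\<lambda>(i, j). if i < r then Q i j else (pderiv ^^ j) (g n)))"
  have M: "M n \<in> carrier_mat (Suc r) (Suc r)" for n by (simp add: M_def)
  have "poly (exc_laguerre_poly a lam mu n) x = poly (det (M n)) x" for n x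
  proof -
    have gsn: "(fs @ [poly (g n)]) ! r = poly (g n)" using len by (simp add: nth_append)
    have "wronskian (fs @ [poly (g n)]) x =
        det (mat (Suc r) (Suc r) (\<lambda>(i, j). (if i \<in> E then exp x else 1) *
          poly (if i < r then Q i j else (pderiv ^^ j) (g n)) x))"
      unfolding wronskian_def
    proof (intro arg_cong[of _ _ det] eq_matI, goal_cases)
      case (1 i j)
      then show ?case
        by (cases "i < r") (auto simp: len nth_append Q higher_deriv_poly E_def less_Suc_eq)
    qed (auto simp: len)
    also have "\<dots> = (\<Prod>i<Suc r. if i \<in> E then exp x else 1) * poly (det (M n)) x"
      unfolding M_def by (rule det_scale_rows_poly)
    also have "(\<Prod>i<Suc r. if i \<in> E then exp x else 1) = (\<Prod>i\<in>{..<Suc r} \<inter> E. exp x)"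
      by (rule prod.inter_restrict [symmetric]) simp
    also have "{..<Suc r} \<inter> E = E" by (auto simp: E_def)
    also have "(\<Prod>i\<in>E. exp x) = exp (real (length mu) * x)"
      by (simp add: E_def r_def exp_of_nat_mult)
    finally have "exp (- real (length mu) * x) * wronskian (fs @ [poly (g n)]) x = poly (det (M n)) x"
      by (simp flip: mult.assoc exp_add)
    moreover have "poly (g n) = laguerre a (n + length lam - (sum_list lam + sum_list mu))"
      by (simp add: g_def poly_laguerre_poly fun_eq_iff)
    ultimately show ?thesis
      by (simp add: poly_exc_laguerre_poly exc_laguerre_def fs_def)
  qed
  then have "exc_laguerre_poly a lam mu n = det (M n)" for n
    by (metis poly_eq_poly_eq_iff ext)
  \<comment> \<open>Deleting the last row removes the dependence on the index, so 0 is an arbitrary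
    representative.\<close>
  moreover have "det (M n) = (\<Sum>j\<le>r. cofactor (M 0) r j * (pderiv ^^ j) (g n))" for n
  proof -
    have "cofactor (M n) r j = cofactor (M 0) r j" for j
    proof -
      have "mat_delete (M n) r j = mat_delete (M 0) r j"
        by (rule eq_matI) (auto simp: mat_delete_def M_def)
      then show ?thesis by (simp add: cofactor_def)
    qed
    then show ?thesis
      unfolding laplace_expansion_row[OF M lessI] lessThan_Suc_atMost
      by (intro sum.cong) (auto simp: M_def mult.commute)
  qed
  ultimately show ?thesis unfolding g_def r_def by (intro exI[of _ "\<lambda>j. cofactor (M 0) r j"]) (simp add: r_def)
qed

section \<open>Nonvanishing of the exceptional polynomials\<close>

lemma higher_deriv_poly_DERIV:
  "((deriv ^^ j) (poly p) has_real_derivative (deriv ^^ Suc j) (poly p) x) (at x)"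
proof -
  have "poly q differentiable (at x)" for q :: "real poly"
    using poly_DERIV real_differentiable_def by blast
  then show ?thesis
    by (simp add: higher_deriv_poly DERIV_deriv_iff_real_differentiable)
qed

lemma higher_deriv_exp_poly_DERIV:
  "((deriv ^^ j) (\<lambda>x. exp x * poly p x) has_real_derivative
    (deriv ^^ Suc j) (\<lambda>x. exp x * poly p x) x) (at x)"
proof -
  obtain q where q: "(deriv ^^ j) (\<lambda>x. exp x * poly p x) = (\<lambda>x. exp x * poly q x)"
    using higher_deriv_exp_poly by blast
  have "(\<lambda>x. exp x * poly q x) differentiable (at x)"
    using poly_DERIV[of q x] DERIV_exp[of x] DERIV_mult real_differentiable_def by blast
  then show ?thesis
    by (simp add: q DERIV_deriv_iff_real_differentiable)
qed

text \<open>The shift by r_1 - j turns a weakly decreasing sequence into a strictly decreasing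
  one.\<close>

lemma inj_on_shifted_part:
  assumes "is_partition lam"
  shows "inj_on (\<lambda>i. shifted_part lam (Suc i)) {..<length lam}"
proof (rule linorder_inj_onI)
  fix i j assume ij: "i < j" "j \<in> {..<length lam}"
  then have "lam ! i \<ge> lam ! j"
    using assms sorted_wrt_nth_less[of "(\<ge>)" lam i j] by (simp add: is_partition_def)
  then show "shifted_part lam (Suc i) \<noteq> shifted_part lam (Suc j)"
    using ij by (simp add: shifted_part_def)
qed auto

text \<open>Otherwise the functions in the Wronskian would be dependent on some interval. The
  polynomial and the exponential part of the relation vanish separately, and within each part the
  degrees are distinct.\<close>

lemma exc_laguerre_poly_neq_0:
  assumes lam: "is_partition lam" and mu: "is_partition mu" and n: "n \<in> degree_seq lam mu"
  shows "exc_laguerre_poly a lam mu n \<noteq> 0"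
proof
  assume P0: "exc_laguerre_poly a lam mu n = 0"
  define r1 r2 where "r1 = length lam" and "r2 = length mu"
  define s where "s = n + length lam - (sum_list lam + sum_list mu)"
  define fs where "fs = seed_functions a lam mu @ [laguerre a s]"
  have len: "length fs = Suc (r1 + r2)"
    by (simp add: fs_def length_seed_functions r1_def r2_def)
  have cases: "i < r1 \<or> (\<exists>i'<r2. i = r1 + i') \<or> i = r1 + r2" if "i < Suc (r1 + r2)" for i
    using that by presburger
  \<comment> \<open>The polynomials among the functions, with L_s moved from position r1 + r2 to
    position r1; \<open>c1\<close> reindexes the coefficients in the same way.\<close>
  define g where "g = (\<lambda>i. laguerre_poly a (if i < r1 then shifted_part lam (Suc i) else s))"
  define G where "G = (\<lambda>i. laguerre_poly a (shifted_part mu (Suc i)) \<circ>\<^sub>p [:0, -1:])"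
  have fs1: "fs ! i = poly (g i)" if "i < r1" for i
    using that seed_functions_nth_lam[of i lam a mu]
    by (simp add: fs_def g_def nth_append length_seed_functions r1_def)
  have fs2: "fs ! (r1 + i) = (\<lambda>x. exp x * poly (G i) x)" if "i < r2" for i
    using that seed_functions_nth_mu[of i mu a lam]
    by (simp add: fs_def G_def nth_append length_seed_functions r1_def r2_def)
  have fs3: "fs ! (r1 + r2) = poly (g r1)"
    by (simp add: fs_def g_def nth_append length_seed_functions r1_def r2_def poly_laguerre_poly fun_eq_iff)
  have "exp (- real (length mu) * x) * wronskian fs x = 0" for x
    using poly_exc_laguerre_poly[of a lam mu n x] P0 by (simp add: exc_laguerre_def fs_def s_def)
  then have W: "wronskian fs x = 0" for x by simp
  have "\<exists>l' u' c. l' < u' \<and> (\<exists>i<length fs. c i \<noteq> 0) \<and>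
      (\<forall>x\<in>{l'<..<u'}. (\<Sum>i<length fs. c i * (fs ! i) x) = 0)"
  proof (rule wronskian_zero_imp_dependent[of _ 0 1])
    fix i j x assume i: "i < length fs"
    consider "i < r1" | i' where "i' < r2" "i = r1 + i'" | "i = r1 + r2"
      using cases i unfolding len by blast
    then show "((deriv ^^ j) (fs ! i) has_real_derivative (deriv ^^ Suc j) (fs ! i) x) (at x)"
      by cases (simp_all only: fs1 fs2 fs3 higher_deriv_poly_DERIV higher_deriv_exp_poly_DERIV)
  qed (use W in auto)
  then obtain l u c where lu: "l < u" and c: "\<exists>i<Suc (r1 + r2). c i \<noteq> 0"
    and sum0: "\<And>x. x \<in> {l<..<u} \<Longrightarrow> (\<Sum>i<Suc (r1 + r2). c i * (fs ! i) x) = 0"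
    unfolding len by blast
  define c1 where "c1 = (\<lambda>i. if i < r1 then c i else c (r1 + r2))"
  define p where "p = (\<Sum>i<Suc r1. Polynomial.smult (c1 i) (g i))"
  define q where "q = (\<Sum>i<r2. Polynomial.smult (c (r1 + i)) (G i))"
  have split: "(\<Sum>i<m + k. h i) = (\<Sum>i<m. h i) + (\<Sum>i<k. h (m + i))" for m k and h :: "nat \<Rightarrow> real"
    by (induction k) simp_all
  have "poly p x + exp x * poly q x = 0" if "x \<in> {l<..<u}" for x
  proof -
    have "(\<Sum>i<Suc (r1 + r2). c i * (fs ! i) x) =
        (\<Sum>i<r1. c i * (fs ! i) x) + (\<Sum>i<r2. c (r1 + i) * (fs ! (r1 + i)) x) +
        c (r1 + r2) * (fs ! (r1 + r2)) x"
      by (simp add: split)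
    also have "(\<Sum>i<r1. c i * (fs ! i) x) = (\<Sum>i<r1. c1 i * poly (g i) x)"
      by (intro sum.cong) (auto simp: fs1 c1_def)
    also have "(\<Sum>i<r2. c (r1 + i) * (fs ! (r1 + i)) x) = exp x * poly q x"
      unfolding q_def poly_sum sum_distrib_left by (intro sum.cong) (auto simp: fs2)
    finally show ?thesis
      using sum0[OF that] by (simp add: p_def poly_sum fs3 c1_def)
  qed
  then have "p = 0" "q = 0" using poly_plus_exp_poly_eq_0[OF lu] by blast+
  have c1: "c1 i = 0" if "i < Suc r1" for i
  proof (rule distinct_degrees_independent[of "{..<Suc r1}" g c1])
    show "inj_on (\<lambda>i. degree (g i)) {..<Suc r1}"
    proof -
      \<comment> \<open>Of the two conditions defining the degree sequence, one prevents truncation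
        in \<open>s\<close> and the other excludes the degrees already taken by seed
        functions.\<close>
      have "s \<noteq> shifted_part lam (Suc i)" if "i < r1" for i
      proof -
        have "int (sum_list lam) + int (sum_list mu) - int r1 \<le> int n"
          "int n - int (sum_list lam) - int (sum_list mu) \<noteq> int (lam ! i) - int (Suc i)"
          using n that unfolding degree_seq_def r1_def by force+
        then show ?thesis using that by (auto simp: s_def shifted_part_def r1_def)
      qed
      then show ?thesis
        using inj_on_shifted_part[OF lam] by (auto simp: inj_on_def g_def r1_def less_Suc_eq)
    qed
    show "(\<Sum>i<Suc r1. Polynomial.smult (c1 i) (g i)) = 0"
      using \<open>p = 0\<close> by (simp only: p_def)
  qed (use that in \<open>auto simp: g_def\<close>)
  have c2: "c (r1 + i) = 0" if "i < r2" for i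
  proof (rule distinct_degrees_independent[of "{..<r2}" G "\<lambda>i. c (r1 + i)"])
    show "inj_on (\<lambda>i. degree (G i)) {..<r2}"
      using inj_on_shifted_part[OF mu] by (simp add: G_def degree_pcompose r2_def)
    show "G i \<noteq> 0" for i
      by (auto simp: G_def dest!: pcompose_eq_0)
    show "(\<Sum>i<r2. Polynomial.smult (c (r1 + i)) (G i)) = 0"
      using \<open>q = 0\<close> by (simp only: q_def)
  qed (use that in auto)
  have "c i = 0" if i: "i < Suc (r1 + r2)" for i
  proof -
    consider "i < r1" | i' where "i' < r2" "i = r1 + i'" | "i = r1 + r2"
      using cases[OF i] by blast
    then show ?thesis
      using c1[of i] c1[of r1] c2 by cases (auto simp: c1_def)
  qed
  then show False using c by blast
qed

text \<open>The constant \<open>D\<close>, independent of \<open>n\<close>, has two roles: s + D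
  caps the number of zeros, and the degree of \<open>V\<close> caps the number of gaps that can lose
  their zero.\<close>

lemma exc_laguerre_poly_reduction:
  "\<exists>D. \<forall>n. let s = n + length lam - (sum_list lam + sum_list mu); g = laguerre_poly a s;
      P = exc_laguerre_poly a lam mu n in
    degree P \<le> s + D \<and>
    (\<exists>U V. [:0, 1:] ^ (length lam + length mu) * P = U * g + V * pderiv g \<and> degree V \<le> D)"
proof -
  define r where "r = length lam + length mu"
  define s where "s = (\<lambda>n. n + length lam - (sum_list lam + sum_list mu))"
  define g where "g = (\<lambda>n. laguerre_poly a (s n))"
  define X where "X = ([:0, 1:] :: real poly)"
  obtain A where A: "\<And>n. exc_laguerre_poly a lam mu n = (\<Sum>j\<le>r. A j * (pderiv ^^ j) (g n))"
    using exc_laguerre_poly_expansion[of a lam mu] unfolding r_def g_def s_def by blast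
  define D where "D = r + (\<Sum>j\<le>r. degree (A j))"
  have dA: "degree (A j) + r \<le> D" if "j \<le> r" for j
    using member_le_sum[of j "{..r}" "\<lambda>j. degree (A j)"] that by (simp add: D_def)
  have dg: "degree ((pderiv ^^ j) (g n)) \<le> s n" for j n
    by (induction j) (auto simp: g_def degree_pderiv)
  have deg: "degree (exc_laguerre_poly a lam mu n) \<le> s n + D" for n
    unfolding A
  proof (rule degree_sum_le)
    fix j assume "j \<in> {..r}"
    then show "degree (A j * (pderiv ^^ j) (g n)) \<le> s n + D"
      using dA[of j] dg[of j n] degree_mult_le[of "A j" "(pderiv ^^ j) (g n)"] by simp
  qed simp
  have "\<exists>U V. X ^ r * exc_laguerre_poly a lam mu n = U * g n + V * pderiv (g n) \<and> degree V \<le> D" for n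
  proof -
    have "\<exists>U V. X ^ j * (pderiv ^^ j) (g n) = U * g n + V * pderiv (g n) \<and> degree V \<le> j" for j
      using laguerre_poly_higher_deriv[of j a "s n"] by (auto simp: X_def g_def)
    then obtain U V where UV: "\<And>j. X ^ j * (pderiv ^^ j) (g n) = U j * g n + V j * pderiv (g n)"
      "\<And>j. degree (V j) \<le> j"
      by metis
    \<comment> \<open>The j-th derivative is reducible after multiplication by \<open>X ^ j\<close>;
      the remaining power of \<open>X\<close> goes into the coefficient.\<close>
    define B where "B = (\<lambda>j. A j * X ^ (r - j))"
    have "X ^ r * exc_laguerre_poly a lam mu n =
        (\<Sum>j\<le>r. B j * U j) * g n + (\<Sum>j\<le>r. B j * V j) * pderiv (g n)"
    proof -
      have "X ^ r * (A j * (pderiv ^^ j) (g n)) = B j * U j * g n + B j * V j * pderiv (g n)"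
        if "j \<le> r" for j
      proof -
        have "X ^ r = X ^ (r - j) * X ^ j" using that by (simp flip: power_add)
        then have "X ^ r * (A j * (pderiv ^^ j) (g n)) = B j * (X ^ j * (pderiv ^^ j) (g n))"
          by (simp add: B_def mult_ac)
        also have "\<dots> = B j * U j * g n + B j * V j * pderiv (g n)"
          unfolding UV(1) by (simp add: distrib_left mult.assoc)
        finally show ?thesis .
      qed
      then show ?thesis
        unfolding A sum_distrib_left sum_distrib_right sum.distrib[symmetric]
        by (intro sum.cong) auto
    qed
    moreover have "degree (\<Sum>j\<le>r. B j * V j) \<le> D"
    proof (rule degree_sum_le)
      fix j assume j: "j \<in> {..r}"
      have "degree (X ^ (r - j)) \<le> r - j"
        using degree_power_le[of X "r - j"] by (simp add: X_def)
      then have "degree (B j) \<le> degree (A j) + (r - j)"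
        unfolding B_def using degree_mult_le[of "A j" "X ^ (r - j)"] by linarith
      then have "degree (B j * V j) \<le> degree (A j) + (r - j) + j"
        using degree_mult_le[of "B j" "V j"] UV(2)[of j] by linarith
      then show "degree (B j * V j) \<le> D" using dA[of j] j by simp
    qed simp
    ultimately show ?thesis by blast
  qed
  with deg show ?thesis
    unfolding Let_def r_def g_def s_def X_def by blast
qed

section \<open>Limit distribution of the regular zeros\<close>

theorem theorem6p5:
  fixes a :: real and lam mu :: "nat list" and f :: "real \<Rightarrow> real"
  assumes "is_partition lam" and "is_partition mu"
    and "a + real (length lam + length mu) > -1"
    and "continuous_on {0<..} f" and "bounded (f ` {0<..})"
  shows "((\<lambda>n. 1 / real (num_regular_zeros a lam mu n) *
             (\<Sum>j = 1..num_regular_zeros a lam mu n.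
                f (regular_zero a lam mu n j / real (num_regular_zeros a lam mu n))))
           \<longlongrightarrow> 1 / (2 * pi) * integral {0..4} (\<lambda>x. f x * sqrt ((4 - x) / x)))
         (inf sequentially (principal (degree_seq lam mu)))"
proof -
  define F where "F = inf sequentially (principal (degree_seq lam mu))"
  define r where "r = length lam + length mu"
  define k where "k = sum_list lam + sum_list mu"
  define s where "s = (\<lambda>n. n + length lam - k)"
  define P where "P = exc_laguerre_poly a lam mu"
  define N where "N = num_regular_zeros a lam mu"
  define Z where "Z = regular_zeros a lam mu"
  obtain D where D: "\<And>n. degree (P n) \<le> s n + D"
    "\<And>n. \<exists>U V. [:0, 1:] ^ r * P n = U * laguerre_poly a (s n) +
      V * pderiv (laguerre_poly a (s n)) \<and> degree V \<le> D"
    using exc_laguerre_poly_reduction[of lam mu a] unfolding Let_def P_def s_def k_def r_def by blast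
  have P0: "eventually (\<lambda>n. P n \<noteq> 0) F"
    using exc_laguerre_poly_neq_0[OF assms(1,2)]
    by (simp add: F_def P_def eventually_inf_principal)
  have s: "filterlim (\<lambda>n. real (s n)) at_top F"
  proof -
    have "filterlim (\<lambda>n. - real k + real n) at_top sequentially"
      by (rule filterlim_tendsto_add_at_top[OF tendsto_const filterlim_real_sequentially])
    then have "filterlim (\<lambda>n. real (s n)) at_top sequentially"
      by (rule filterlim_at_top_mono) (auto simp: s_def intro!: always_eventually)
    then show ?thesis
      by (rule filterlim_mono) (simp_all add: F_def)
  qed
  have Zpos: "x > 0" if "x \<in># Z n" for n x
    using that by (simp add: Z_def regular_zeros_def)
  have NZ: "N n = size (Z n)" for n by (simp add: N_def Z_def num_regular_zeros_def)
  have Nle: "N n \<le> s n + D" for n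
    using size_filter_mset_lesseq[of "\<lambda>x. x > 0" "proots (P n)"] size_proots_le[of "P n"] D(1)[of n]
    unfolding NZ Z_def regular_zeros_def P_def by (meson le_trans)
  \<comment> \<open>The scale \<open>c\<close> stays open because N(n) can be inserted only once
    N(n) ~ s is known. Where \<open>c n\<close> is 0, division would send zeros to 0, outside the
    domain of \<open>h\<close>; hence the condition that there are none.\<close>
  have key: "eventually (\<lambda>n. c n * (integral {0..4} (\<lambda>x. h x * mp_density x) - \<epsilon>) \<le>
      (\<Sum>x\<in>#Z n. h (x / c n))) F"
    if cs: "((\<lambda>n. c n / real (s n)) \<longlongrightarrow> 1) F" and c0: "\<And>n. c n \<ge> 0" "\<And>n. c n = 0 \<Longrightarrow> Z n = {#}"
      and h: "continuous_on {0<..} h" "\<And>x. x > 0 \<Longrightarrow> 0 \<le> h x" "\<And>x. x > 0 \<Longrightarrow> h x \<le> C" and \<epsilon>: "\<epsilon> > 0"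
    for c h C \<epsilon>
  proof -
    define X where "X = (\<lambda>n. image_mset (\<lambda>x. x / c n) (Z n))"
    have "eventually (\<lambda>n. c n * (integral {0..4} (\<lambda>x. h x * mp_density x) - \<epsilon>) \<le>
        (\<Sum>x\<in>#X n. h x)) F"
    proof (rule eventually_sum_ge_mp_integral[OF _ _ _ h \<epsilon>])
      fix u v \<kappa> :: real
      assume *: "0 < u" "u < v" "v < 4" "0 < \<kappa>" "\<kappa> < mp_density v"
      have "eventually (\<lambda>n. 0 < c n / real (s n)) F"
        using cs by (rule order_tendstoD) simp
      then show "eventually (\<lambda>n. c n * ((v - u) * \<kappa>) \<le> real (size {#x \<in># X n. u < x \<and> x < v#})) F"
        using eventually_card_zeros_ge[OF P0 D(2) s cs *] P0
      proof eventually_elim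
        case (elim n)
        have c: "c n > 0" using elim(1) c0(1)[of n] by (auto simp: zero_less_divide_iff)
        define S where "S = {#x \<in># Z n. u < x / c n \<and> x / c n < v#}"
        have "{z\<in>{c n * u<..<c n * v}. poly (P n) z = 0} \<subseteq> set_mset S"
        proof
          fix z assume z: "z \<in> {z\<in>{c n * u<..<c n * v}. poly (P n) z = 0}"
          then have "0 < z" using c *(1) by (auto intro: less_trans[OF mult_pos_pos])
          then show "z \<in> set_mset S"
            using z elim(3) c by (auto simp: S_def Z_def regular_zeros_def P_def field_simps)
        qed
        then have "card {z\<in>{c n * u<..<c n * v}. poly (P n) z = 0} \<le> card (set_mset S)"
          by (intro card_mono) auto
        \<comment> \<open>The lower bound counts distinct zeros; multiplicities only help.\<close>
        also have "\<dots> \<le> size S"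
          unfolding card_eq_sum size_multiset_overloaded_eq
          by (intro sum_mono) (simp add: Suc_le_eq)
        also have "size S = size {#x \<in># X n. u < x \<and> x < v#}"
          by (simp add: X_def S_def filter_mset_image_mset)
        finally show ?case using elim(2) by linarith
      qed
    next
      fix n x assume "x \<in># X n"
      then obtain z where z: "z \<in># Z n" "x = z / c n" by (auto simp: X_def)
      then have "c n > 0" using c0[of n] by (cases "c n = 0") (auto simp: less_le)
      then show "x > 0" using z Zpos[of z n] by simp
    qed (use c0 in \<open>auto intro: always_eventually\<close>)
    then show ?thesis by (simp add: X_def multiset.map_comp o_def)
  qed
  have s0: "eventually (\<lambda>n. real (s n) > 0) F"
    using s unfolding filterlim_at_top_dense by blast
  have inv_s: "((\<lambda>n. 1 / real (s n)) \<longlongrightarrow> 0) F"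
    using tendsto_inverse_0_at_top[OF s] by (simp add: inverse_eq_divide)
  have s1: "((\<lambda>n. (real (s n) + 1) / real (s n)) \<longlongrightarrow> 1) F"
  proof (rule Lim_transform_eventually)
    show "((\<lambda>n. 1 + 1 / real (s n)) \<longlongrightarrow> 1) F"
      using tendsto_add[OF tendsto_const inv_s, of 1] by simp
  qed (use s0 in \<open>auto elim!: eventually_mono simp: field_simps\<close>)
  \<comment> \<open>From below, the constant function 1 and the total mass 1; from above, the degree
    bound. The scale s + 1 is positive for every \<open>n\<close>, whereas \<open>s n\<close> may be
    0.\<close>
  have Ns1: "((\<lambda>n. real (N n) / (real (s n) + 1)) \<longlongrightarrow> 1) F"
  proof (rule order_tendstoI)
    fix l :: real assume l: "l < 1"
    have "integral {0..4} (\<lambda>x. 1 * mp_density x) = 1"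
      using mp_density_has_integral by (simp add: integral_unique)
    moreover have "eventually (\<lambda>n. (real (s n) + 1) *
        (integral {0..4} (\<lambda>x. 1 * mp_density x) - (1 - l) / 2) \<le> (\<Sum>x\<in>#Z n. 1)) F"
      using l by (intro key[where h = "\<lambda>_. 1" and C = 1]) (auto intro!: s1 simp: add_nonneg_eq_0_iff)
    ultimately have "eventually (\<lambda>n. (real (s n) + 1) * (1 - (1 - l) / 2) \<le> real (N n)) F"
      by (simp add: NZ)
    then show "eventually (\<lambda>n. l < real (N n) / (real (s n) + 1)) F"
    proof eventually_elim
      case (elim n)
      then have "1 - (1 - l) / 2 \<le> real (N n) / (real (s n) + 1)"
        by (simp add: pos_le_divide_eq mult.commute)
      moreover have "l < 1 - (1 - l) / 2" using l by (simp add: field_simps)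
      ultimately show ?case by linarith
    qed
  next
    fix u :: real assume u: "1 < u"
    have "((\<lambda>n. 1 + real D * (1 / real (s n))) \<longlongrightarrow> 1 + real D * 0) F"
      by (intro tendsto_intros inv_s)
    then have "eventually (\<lambda>n. 1 + real D * (1 / real (s n)) < u) F"
      by (rule order_tendstoD) (use u in simp)
    then show "eventually (\<lambda>n. real (N n) / (real (s n) + 1) < u) F"
      using s0
    proof eventually_elim
      case (elim n)
      have "real (N n) / (real (s n) + 1) \<le> (real (s n) + real D) / (real (s n) + 0)"
        using elim of_nat_mono[OF Nle[of n], where 'a = real] by (intro frac_le) auto
      also have "\<dots> = 1 + real D * (1 / real (s n))"
        using elim by (simp add: field_simps)
      finally show ?case using elim by simp
    qed
  qed
  have Ns: "((\<lambda>n. real (N n) / real (s n)) \<longlongrightarrow> 1) F"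
  proof -
    have "((\<lambda>n. real (N n) / (real (s n) + 1) * ((real (s n) + 1) / real (s n))) \<longlongrightarrow> 1 * 1) F"
      by (intro tendsto_mult Ns1 s1)
    moreover have "real (s n) + 1 \<noteq> 0" for n by linarith
    ultimately show ?thesis by simp
  qed
  have N0: "eventually (\<lambda>n. real (N n) > 0) F"
    using order_tendstoD(1)[OF Ns, of 0] by (auto elim!: eventually_mono simp: zero_less_divide_iff)
  obtain C where C: "\<And>x. x > 0 \<Longrightarrow> \<bar>f x\<bar> \<le> C"
    using assms(5) by (auto simp: bounded_iff)
  define I where "I = integral {0..4} (\<lambda>x. f x * mp_density x)"
  have fint: "(\<lambda>x. f x * mp_density x) integrable_on {0..4}"
    using assms(4) C by (rule mult_mp_density_integrable)
  have mpint: "((\<lambda>x. C * mp_density x) has_integral C) {0..4}"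
    using has_integral_mult_right[OF mp_density_has_integral, of C] by simp
  define A where "A = (\<lambda>n. 1 / real (N n) * (\<Sum>x\<in>#Z n. f (x / real (N n))))"
  have sumC: "(\<Sum>x\<in>#M. C) = C * real (size M)" for M :: "real multiset" by simp
  have "(A \<longlongrightarrow> I) F"
  proof (rule tendstoI)
    fix \<epsilon> :: real assume "\<epsilon> > 0"
    then have \<epsilon>: "\<epsilon> / 2 > 0" by simp
    have Ncond: "real (N n) \<ge> 0" "real (N n) = 0 \<Longrightarrow> Z n = {#}" for n by (simp_all add: NZ)
    \<comment> \<open>Adding \<open>C\<close> makes both functions nonnegative at no cost: the
      constant contributes exactly C N(n) to the sum and exactly \<open>C\<close> to the integral,
      so the bound for C - f is an upper bound for \<open>f\<close>.\<close>
    have "integral {0..4} (\<lambda>x. (C + f x) * mp_density x) = C + I"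
      using integral_add[OF has_integral_integrable[OF mpint] fint] integral_unique[OF mpint]
      by (simp add: distrib_right I_def)
    moreover have "eventually (\<lambda>n. real (N n) * (integral {0..4} (\<lambda>x. (C + f x) * mp_density x) - \<epsilon> / 2) \<le>
        (\<Sum>x\<in>#Z n. C + f (x / real (N n)))) F"
      using C by (intro key[OF Ns Ncond _ _ _ \<epsilon>, where C = "2 * C"] continuous_intros assms(4))
        (force simp: abs_le_iff)+
    moreover have "integral {0..4} (\<lambda>x. (C - f x) * mp_density x) = C - I"
      using integral_diff[OF has_integral_integrable[OF mpint] fint] integral_unique[OF mpint]
      by (simp add: left_diff_distrib I_def)
    moreover have "eventually (\<lambda>n. real (N n) * (integral {0..4} (\<lambda>x. (C - f x) * mp_density x) - \<epsilon> / 2) \<le>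
        (\<Sum>x\<in>#Z n. C - f (x / real (N n)))) F"
      using C by (intro key[OF Ns Ncond _ _ _ \<epsilon>, where C = "2 * C"] continuous_intros assms(4))
        (force simp: abs_le_iff)+
    ultimately have "eventually (\<lambda>n. real (N n) * (C + I - \<epsilon> / 2) \<le> (\<Sum>x\<in>#Z n. C + f (x / real (N n)))) F"
      "eventually (\<lambda>n. real (N n) * (C - I - \<epsilon> / 2) \<le> (\<Sum>x\<in>#Z n. C - f (x / real (N n)))) F"
      by simp_all
    then show "eventually (\<lambda>n. dist (A n) I < \<epsilon>) F"
      using N0
    proof eventually_elim
      case (elim n)
      define S where "S = (\<Sum>x\<in>#Z n. f (x / real (N n)))"
      have "(\<Sum>x\<in>#Z n. C + f (x / real (N n))) = C * real (N n) + S"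
        unfolding S_def NZ sumC[symmetric] by (rule sum_mset.distrib)
      moreover have "(\<Sum>x\<in>#Z n. C - f (x / real (N n))) + S = C * real (N n)"
        unfolding S_def sum_mset.distrib[symmetric] by (simp add: NZ)
      ultimately have "real (N n) * (I - \<epsilon> / 2) \<le> S" "S \<le> real (N n) * (I + \<epsilon> / 2)"
        using elim by (simp_all add: algebra_simps)
      then have "I - \<epsilon> / 2 \<le> S / real (N n)" "S / real (N n) \<le> I + \<epsilon> / 2"
        using elim(3) by (simp_all add: field_simps)
      moreover have "A n = S / real (N n)"
        unfolding A_def S_def times_divide_eq_left mult_1_left ..
      ultimately show ?case using \<open>\<epsilon> > 0\<close> by (simp add: dist_real_def)
    qed
  qed
  \<comment> \<open>Sums over the multiset of zeros ignore their order; the sorted list and its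
    indices starting at 1 matter only here.\<close>
  moreover have "A = (\<lambda>n. 1 / real (N n) *
      (\<Sum>j = 1..N n. f (regular_zero a lam mu n j / real (N n))))"
  proof
    fix n
    define xs where "xs = sorted_list_of_multiset (Z n)"
    have Zxs: "Z n = mset xs" by (simp add: xs_def)
    have len: "length xs = N n" by (simp add: NZ Zxs)
    have "(\<Sum>x\<in>#Z n. f (x / real (N n))) = sum_list (map (\<lambda>x. f (x / real (N n))) xs)"
      unfolding Zxs by (simp flip: sum_mset_sum_list)
    also have "\<dots> = (\<Sum>i<N n. f (xs ! i / real (N n)))"
      by (simp add: sum_list_sum_nth len atLeast0LessThan)
    also have "\<dots> = (\<Sum>j = 1..N n. f (regular_zero a lam mu n j / real (N n)))"
      by (rule sum.reindex_bij_witness[of _ "\<lambda>j. j - 1" Suc])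
        (auto simp: regular_zero_def xs_def Z_def)
    finally show "A n = 1 / real (N n) *
        (\<Sum>j = 1..N n. f (regular_zero a lam mu n j / real (N n)))" by (simp only: A_def)
  qed
  moreover have "I = 1 / (2 * pi) * integral {0..4} (\<lambda>x. f x * sqrt ((4 - x) / x))"
  proof -
    have "I = integral {0..4} (\<lambda>x. 1 / (2 * pi) * (f x * sqrt ((4 - x) / x)))"
      by (simp add: I_def mp_density_def)
    then show ?thesis by (simp only: integral_mult_right)
  qed
  ultimately show ?thesis by (simp only: F_def N_def)
qed

end
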